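(* Let $f\in \mathrm{PSL}(2,\mathbb{C})$ be a hyperbolic element, a parabolic element, or a primitive elliptic element of order $n\geq 3$. Let $g\in \mathrm{PSL}(2,\mathbb{C})$ be a parabolic element, and let $\Gamma=\langle f,g\rangle$ be a non-elementary $\mathcal{RP}$ group without invariant plane. Then: (1) there exists an element $h\in \mathrm{PSL}(2,\mathbb{C})$ such that $h^2=fgf^{-1}g^{-1}$ and $(hg)^2=1$; (2) for $h$ as in (1), the group $\Gamma=\langle f,g\rangle$ is discrete if and only if $h$ is a hyperbolic element, a parabolic element, or a primitive elliptic element of order $p$ for some integer $p\geq 3$.
   Context: $\mathrm{PSL}(2,\mathbb{C})$ is identified with the group of orientation-preserving isometries of hyperbolic 3-space $\mathbb{H}^3$. For $f,g\in\mathrm{PSL}(2,\mathbb{C})$ put $\beta(f)=\mathrm{tr}^2 f-4$, $\beta(g)=\mathrm{tr}^2 g-4$ and $\gamma(f,g)=\mathrm{tr}[f,g]-2$, where $[f,g]=fgf^{-1}g^{-1}$; these are computed with any lifts to $\mathrm{SL}(2,\mathbb{C})$ and do not depend on the lifts. A (nonidentity) element $f\in\mathrm{PSL}(2,\mathbb{C})$ with real $\beta(f)$ is elliptic if $\beta(f)\in[-4,0)$, parabolic if $\beta(f)=0$, hyperbolic if $\beta(f)\in(0,+\infty)$, and $\pi$-loxodromic if $\beta(f)\in(-\infty,-4)$. An elliptic element of order $n$ is called primitive if it is a rotation through angle $2\pi/n$ about its axis, and non-primitive if it is a rotation through $2\pi k/n$ with $k$ and $n$ coprime, $1<k<n/2$.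 A two-generator group $\Gamma=\langle f,g\rangle$ is an $\mathcal{RP}$ group (group with real parameters) if $f,g\in\mathrm{PSL}(2,\mathbb{C})$ and $\beta(f),\beta(g),\gamma(f,g)\in\mathbb{R}$. "Without invariant plane" means that no hyperbolic plane in $\mathbb{H}^3$ is mapped to itself by all elements of $\Gamma$. *)

theory Defs
  imports "HOL-Analysis.Analysis" "HOL-Algebra.Algebra"
begin

definition SL2C :: "(complex^2^2) monoid"
  where "SL2C = \<lparr>carrier = {A. det A = 1}, mult = (**), one = mat 1\<rparr>"

text \<open>An element of \<open>PSL2C\<close> is a coset, i.e. the set \<open>{A, -A}\<close> of its two lifts.\<close>

definition PSL2C :: "(complex^2^2) set monoid"
  where "PSL2C = SL2C Mod {mat 1, - mat 1}"

definition lift :: "(complex^2^2) set \<Rightarrow> complex^2^2"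
  where "lift f = (SOME A. A \<in> f)"

lemma group_SL2C: "group SL2C"
proof (rule groupI)
  fix A assume A: "A \<in> carrier SL2C"
  then have "invertible A" by (simp add: SL2C_def invertible_det_nz)
  then obtain B where B: "A ** B = mat 1" "B ** A = mat 1"
    unfolding invertible_def by blast
  have "det B * det A = 1" using B(2) by (metis det_I det_mul)
  with A have "det B = 1" by (simp add: SL2C_def)
  with B show "\<exists>B\<in>carrier SL2C. B \<otimes>\<^bsub>SL2C\<^esub> A = \<one>\<^bsub>SL2C\<^esub>" by (auto simp: SL2C_def)
qed (auto simp: SL2C_def det_mul det_I matrix_mul_assoc)

lemma neg_mult_2: "(- A) ** B = - (A ** (B :: complex^2^2))"
  "A ** (- B) = - (A ** (B :: complex^2^2))"
  by (simp_all add: matrix_matrix_mult_def vec_eq_iff sum_negf)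

lemma det_neg_2: "det (- A) = det (A :: complex^2^2)"
  by (simp add: det_2)

lemma normal_signs: "{mat 1, - mat 1} \<lhd> SL2C"
proof -
  interpret group SL2C by (rule group_SL2C)
  have sub: "{mat 1, - mat 1} \<subseteq> carrier SL2C"
    by (auto simp: SL2C_def det_neg_2 det_I)
  have mm: "(- mat 1) \<otimes>\<^bsub>SL2C\<^esub> (- mat 1) = \<one>\<^bsub>SL2C\<^esub>"
    by (simp add: SL2C_def neg_mult_2)
  have inv: "inv\<^bsub>SL2C\<^esub> (- mat 1) = - mat 1"
    using inv_equality[OF mm] sub by auto
  have inv1: "inv\<^bsub>SL2C\<^esub> (mat 1) = mat 1"
    using inv_one by (simp add: SL2C_def)
  have "subgroup {mat 1, - mat 1} SL2C"
    using sub inv inv1 by unfold_locales (auto simp: SL2C_def neg_mult_2)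
  moreover have "A \<otimes>\<^bsub>SL2C\<^esub> s \<otimes>\<^bsub>SL2C\<^esub> inv\<^bsub>SL2C\<^esub> A \<in> {mat 1, - mat 1}"
    if A: "A \<in> carrier SL2C" and s: "s \<in> {mat 1, - mat 1}" for A s
  proof -
    have "A ** (inv\<^bsub>SL2C\<^esub> A) = mat 1" using r_inv[OF A] by (simp add: SL2C_def)
    then show ?thesis using s by (auto simp: SL2C_def neg_mult_2)
  qed
  ultimately show ?thesis by (auto simp: normal_inv_iff)
qed

lemma group_PSL2C: "group PSL2C"
  unfolding PSL2C_def using normal_signs by (rule normal.factorgroup_is_group)

lemma coset_signs: "{mat 1, - mat 1} #>\<^bsub>SL2C\<^esub> A = {A, - A}"
  by (auto simp: r_coset_def SL2C_def neg_mult_2)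

lemma carrier_PSL2C: "carrier PSL2C = (\<lambda>A. {A, - A}) ` carrier SL2C"
  by (auto simp: PSL2C_def FactGroup_def RCOSETS_def coset_signs)

lemma PSL2C_lifts:
  assumes "f \<in> carrier PSL2C" "A \<in> f"
  shows "A \<in> carrier SL2C" "f = {A, - A}"
  using assms by (auto simp: carrier_PSL2C SL2C_def det_neg_2)

lemma lift_in: "f \<in> carrier PSL2C \<Longrightarrow> lift f \<in> f"
  unfolding lift_def by (rule someI_ex) (auto simp: carrier_PSL2C)

lemma lift_cases:
  assumes "f \<in> carrier PSL2C" "A \<in> f"
  shows "lift f = A \<or> lift f = - A"
  using PSL2C_lifts(2)[OF assms] lift_in[OF assms(1)] by blast

lemma neg_inv_SL2C:
  assumes "A \<in> carrier SL2C"
  shows "inv\<^bsub>SL2C\<^esub> (- A) = - (inv\<^bsub>SL2C\<^esub> A)"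
proof -
  interpret group SL2C by (rule group_SL2C)
  have "(inv\<^bsub>SL2C\<^esub> A) ** A = mat 1" using l_inv[OF assms] by (simp add: SL2C_def)
  then have "(- (inv\<^bsub>SL2C\<^esub> A)) \<otimes>\<^bsub>SL2C\<^esub> (- A) = \<one>\<^bsub>SL2C\<^esub>"
    by (simp add: SL2C_def neg_mult_2)
  moreover have "- A \<in> carrier SL2C" "- (inv\<^bsub>SL2C\<^esub> A) \<in> carrier SL2C"
    using assms inv_closed[OF assms] by (auto simp: SL2C_def det_neg_2)
  ultimately show ?thesis by (metis inv_equality)
qed

definition beta :: "(complex^2^2) set \<Rightarrow> complex"
  where "beta f = (trace (lift f))\<^sup>2 - 4"

definition gamma :: "(complex^2^2) set \<Rightarrow> (complex^2^2) set \<Rightarrow> complex"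
  where "gamma f g = trace (lift f \<otimes>\<^bsub>SL2C\<^esub> lift g \<otimes>\<^bsub>SL2C\<^esub> inv\<^bsub>SL2C\<^esub> (lift f) \<otimes>\<^bsub>SL2C\<^esub> inv\<^bsub>SL2C\<^esub> (lift g)) - 2"

lemma beta_any_lift:
  assumes "f \<in> carrier PSL2C" "A \<in> f"
  shows "beta f = (trace A)\<^sup>2 - 4"
proof -
  have "trace (- A) = - trace A" by (simp add: trace_def sum_negf)
  then show ?thesis using lift_cases[OF assms] by (auto simp: beta_def)
qed

lemma gamma_any_lift:
  assumes f: "f \<in> carrier PSL2C" "A \<in> f" and g: "g \<in> carrier PSL2C" "B \<in> g"
  shows "gamma f g = trace (A \<otimes>\<^bsub>SL2C\<^esub> B \<otimes>\<^bsub>SL2C\<^esub> (inv\<^bsub>SL2C\<^esub> A) \<otimes>\<^bsub>SL2C\<^esub> (inv\<^bsub>SL2C\<^esub> B)) - 2"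
proof -
  have mult: "monoid.mult SL2C = (**)" by (simp add: SL2C_def)
  have inv_neg: "inv\<^bsub>SL2C\<^esub> (- A) = - (inv\<^bsub>SL2C\<^esub> A)" "inv\<^bsub>SL2C\<^esub> (- B) = - (inv\<^bsub>SL2C\<^esub> B)"
    using PSL2C_lifts(1)[OF f] PSL2C_lifts(1)[OF g] by (simp_all only: neg_inv_SL2C)
  consider "lift f = A" "lift g = B" | "lift f = A" "lift g = - B"
    | "lift f = - A" "lift g = B" | "lift f = - A" "lift g = - B"
    using lift_cases[OF f] lift_cases[OF g] by argo
  then show ?thesis
    by cases (simp_all only: gamma_def inv_neg mult neg_mult_2 minus_minus)
qed

definition RP_group :: "(complex^2^2) set \<Rightarrow> (complex^2^2) set \<Rightarrow> bool"
  where "RP_group f g \<longleftrightarrow> f \<in> carrier PSL2C \<and> g \<in> carrier PSL2C \<and>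
    beta f \<in> \<real> \<and> beta g \<in> \<real> \<and> gamma f g \<in> \<real>"

text \<open>Upper half-space model; a point is \<open>(z, t)\<close> with height \<open>t > 0\<close>.\<close>

definition H3 :: "(complex \<times> real) set"
  where "H3 = {(z, t). t > 0}"

text \<open>The Poincare extension of the Moebius transformation of a matrix of determinant 1. The formula
  does not change when all entries change sign, so the choice of lift does not matter.\<close>

definition act_H3 :: "(complex^2^2) set \<Rightarrow> complex \<times> real \<Rightarrow> complex \<times> real"
  where "act_H3 f = (\<lambda>(z, t).
    let a = lift f $ 1 $ 1; b = lift f $ 1 $ 2; c = lift f $ 2 $ 1; d = lift f $ 2 $ 2;
        N = (cmod (c * z + d))\<^sup>2 + (cmod c)\<^sup>2 * t\<^sup>2
    in (((a * z + b) * cnj (c * z + d) + a * cnj c * of_real (t\<^sup>2)) / of_real N, t / N))"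

text \<open>Action on the Riemann sphere; \<open>None\<close> is the point at infinity.\<close>

definition act_sphere :: "(complex^2^2) set \<Rightarrow> complex option \<Rightarrow> complex option"
  where "act_sphere f w =
    (let a = lift f $ 1 $ 1; b = lift f $ 1 $ 2; c = lift f $ 2 $ 1; d = lift f $ 2 $ 2
     in case w of
          None \<Rightarrow> if c = 0 then None else Some (a / c)
        | Some z \<Rightarrow> if c * z + d = 0 then None else Some ((a * z + b) / (c * z + d)))"

text \<open>Hyperbolic planes are the hemispheres centred on, and the vertical Euclidean half-planes
  orthogonal to, the boundary plane \<open>t = 0\<close>.\<close>

definition hyperbolic_plane :: "(complex \<times> real) set \<Rightarrow> bool"
  where "hyperbolic_plane P \<longleftrightarrow>
    (\<exists>c r. r > 0 \<and> P = {(z, t). t > 0 \<and> (cmod (z - c))\<^sup>2 + t\<^sup>2 = r\<^sup>2}) \<or>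
    (\<exists>c u. u \<noteq> 0 \<and> P = {(z, t). t > 0 \<and> u \<bullet> (z - c) = 0})"

definition has_invariant_plane :: "(complex^2^2) set set \<Rightarrow> bool"
  where "has_invariant_plane \<Gamma> \<longleftrightarrow> (\<exists>P. hyperbolic_plane P \<and> (\<forall>x\<in>\<Gamma>. act_H3 x ` P = P))"

text \<open>A group is elementary if it has a finite orbit in the closed hyperbolic space, that is,
  in hyperbolic space together with its sphere at infinity.\<close>

definition elementary :: "(complex^2^2) set set \<Rightarrow> bool"
  where "elementary \<Gamma> \<longleftrightarrow>
    (\<exists>p\<in>H3. finite ((\<lambda>x. act_H3 x p) ` \<Gamma>)) \<or> (\<exists>w. finite ((\<lambda>x. act_sphere x w) ` \<Gamma>))"

definition elliptic :: "(complex^2^2) set \<Rightarrow> bool"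
  where "elliptic f \<longleftrightarrow> f \<in> carrier PSL2C \<and> f \<noteq> \<one>\<^bsub>PSL2C\<^esub> \<and>
    (\<exists>b::real. beta f = of_real b \<and> - 4 \<le> b \<and> b < 0)"

definition parabolic :: "(complex^2^2) set \<Rightarrow> bool"
  where "parabolic f \<longleftrightarrow> f \<in> carrier PSL2C \<and> f \<noteq> \<one>\<^bsub>PSL2C\<^esub> \<and> beta f = 0"

definition hyperbolic :: "(complex^2^2) set \<Rightarrow> bool"
  where "hyperbolic f \<longleftrightarrow> f \<in> carrier PSL2C \<and> f \<noteq> \<one>\<^bsub>PSL2C\<^esub> \<and>
    (\<exists>b::real. beta f = of_real b \<and> b > 0)"

text \<open>The axis of the rotation is the image under \<open>q\<close> of the vertical geodesic over \<open>0\<close>.\<close>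

definition is_rotation :: "real \<Rightarrow> (complex^2^2) set \<Rightarrow> bool"
  where "is_rotation \<theta> f \<longleftrightarrow> (\<exists>q\<in>carrier PSL2C.
    \<forall>(z, t)\<in>H3. act_H3 f (act_H3 q (z, t)) = act_H3 q (cis \<theta> * z, t))"

definition primitive_elliptic :: "nat \<Rightarrow> (complex^2^2) set \<Rightarrow> bool"
  where "primitive_elliptic n f \<longleftrightarrow>
    elliptic f \<and> group.ord PSL2C f = n \<and> is_rotation (2 * pi / real n) f"

text \<open>The quotient topology, by \<open>quotient_map_PSL2C\<close> below.\<close>

definition PSL2C_topology :: "(complex^2^2) set topology"
  where "PSL2C_topology = topology (\<lambda>U. U \<subseteq> carrier PSL2C \<and> openin (top_of_set (carrier SL2C)) (\<Union>U))"

lemma Union_Int_PSL2C: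
  assumes "U \<subseteq> carrier PSL2C" "V \<subseteq> carrier PSL2C"
  shows "\<Union>(U \<inter> V) = \<Union>U \<inter> \<Union>V"
proof
  show "\<Union>U \<inter> \<Union>V \<subseteq> \<Union>(U \<inter> V)"
  proof
    fix A assume "A \<in> \<Union>U \<inter> \<Union>V"
    then obtain f g where fg: "f \<in> U" "A \<in> f" "g \<in> V" "A \<in> g" by blast
    have "f = g" using PSL2C_lifts(2)[of f A] PSL2C_lifts(2)[of g A] assms fg by blast
    with fg show "A \<in> \<Union>(U \<inter> V)" by blast
  qed
qed blast

lemma openin_PSL2C_topology:
  "openin PSL2C_topology U \<longleftrightarrow>
     U \<subseteq> carrier PSL2C \<and> openin (top_of_set (carrier SL2C)) (\<Union>U)"
proof -
  have "istopology (\<lambda>U. U \<subseteq> carrier PSL2C \<and> openin (top_of_set (carrier SL2C)) (\<Union>U))"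
    unfolding istopology_def
  proof (intro conjI allI impI)
    fix K assume K: "\<forall>U\<in>K. U \<subseteq> carrier PSL2C \<and> openin (top_of_set (carrier SL2C)) (\<Union>U)"
    then show "\<Union>K \<subseteq> carrier PSL2C" by blast
    have "\<Union>(\<Union>K) = \<Union>(Union ` K)" by blast
    then show "openin (top_of_set (carrier SL2C)) (\<Union>(\<Union>K))"
      using K by (simp only:) (rule openin_Union, elim imageE, simp)
  next
    fix U V assume "U \<subseteq> carrier PSL2C \<and> openin (top_of_set (carrier SL2C)) (\<Union>U)"
      and "V \<subseteq> carrier PSL2C \<and> openin (top_of_set (carrier SL2C)) (\<Union>V)"
    then show "openin (top_of_set (carrier SL2C)) (\<Union>(U \<inter> V))"
      by (simp add: Union_Int_PSL2C openin_Int)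
  qed blast
  then show ?thesis unfolding PSL2C_topology_def by (simp add: topology_inverse')
qed

lemma Union_carrier_PSL2C: "\<Union>(carrier PSL2C) = carrier SL2C"
proof
  show "\<Union>(carrier PSL2C) \<subseteq> carrier SL2C"
    by (intro Union_least subsetI) (rule PSL2C_lifts(1))
  show "carrier SL2C \<subseteq> \<Union>(carrier PSL2C)"
    unfolding carrier_PSL2C by blast
qed

lemma topspace_PSL2C: "topspace PSL2C_topology = carrier PSL2C"
proof -
  have "openin PSL2C_topology (carrier PSL2C)"
    by (simp add: openin_PSL2C_topology Union_carrier_PSL2C)
  then show ?thesis
    by (metis openin_PSL2C_topology openin_subset openin_topspace subset_antisym)
qed

lemma quotient_map_PSL2C:
  "quotient_map (top_of_set (carrier SL2C)) PSL2C_topology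
     (\<lambda>A. {mat 1, - mat 1} #>\<^bsub>SL2C\<^esub> A)"
proof -
  have "{A \<in> carrier SL2C. {A, - A} \<in> U} = \<Union>U" if U: "U \<subseteq> carrier PSL2C" for U
  proof (intro equalityI subsetI)
    fix A assume "A \<in> \<Union>U"
    then obtain f where f: "f \<in> U" "A \<in> f" by (elim UnionE)
    then have "f \<in> carrier PSL2C" using U by (elim subsetD)
    then show "A \<in> {A \<in> carrier SL2C. {A, - A} \<in> U}"
      using f PSL2C_lifts[of f A] by simp
  qed auto
  then have "openin (top_of_set (carrier SL2C)) {A \<in> carrier SL2C. {A, - A} \<in> U} \<longleftrightarrow>
      openin PSL2C_topology U" if "U \<subseteq> carrier PSL2C" for U
    using that by (simp only: openin_PSL2C_topology) simp
  then show ?thesis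
    unfolding quotient_map_def coset_signs topspace_PSL2C topspace_euclidean_subtopology
    by (intro conjI allI impI) (simp_all only: carrier_PSL2C)
qed

definition discrete_PSL2C :: "(complex^2^2) set set \<Rightarrow> bool"
  where "discrete_PSL2C \<Gamma> \<longleftrightarrow> subtopology PSL2C_topology \<Gamma> = discrete_topology \<Gamma>"

end

theory Submission
  imports Defs
begin

text \<open>
  Everything becomes explicit in one coordinate system. Conjugate \<open>g\<close> to the translation
  \<open>z \<mapsto> z + 1\<close>. Since the group fixes no boundary point, \<open>f\<close> then has a lower left entry \<open>c \<noteq> 0\<close>,
  and a further translation makes its upper left entry zero. Then \<open>\<gamma>(f, g) = c\<^sup>2\<close> is real.
  If \<open>c\<close> were real, both matrices would be real and the plane over the real axis would be invariant; so \<open>c = \<i> r\<close>, and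
  with \<open>\<tau>\<close> the (real) trace of \<open>f\<close> the group is determined by \<open>r > 0\<close> and \<open>\<tau>\<close>
  (\<open>normal_form\<close>). In these coordinates the conditions on \<open>h\<close> are polynomial equations, and
  they have exactly one solution up to sign: the real matrix \<open>hecke r\<close>, of trace \<open>r\<close>
  (\<open>hecke_characterization\<close>). So \<open>h\<close> is of one of the three listed types precisely when
  \<open>r \<ge> 2\<close> or \<open>r = 2 cos (\<pi> / p)\<close> with \<open>p \<ge> 3\<close>, which is \<open>mirror_bound r\<close>, and the hypothesis on
  \<open>f\<close> says the same of \<open>\<bar>\<tau>\<bar>\<close>.

  If these conditions hold, the group is discrete because it lies in a reflection group. The planes
  \<open>Re z = 0\<close>, \<open>Re z = 1/2\<close>, \<open>\<bar>z\<bar>\<^sup>2 + t\<^sup>2 = 1/r\<^sup>2\<close> and \<open>Im z = \<tau>/(2r)\<close>, with reflections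
  \<open>R\<^sub>1, \<dots>, R\<^sub>4\<close>, satisfy \<open>g = R\<^sub>2 R\<^sub>1\<close> and \<open>f = R\<^sub>3 R\<^sub>4\<close>, while \<open>h = R\<^sub>3 R\<^sub>2\<close>. Consecutive planes are
  tangent (1 and 2) or meet at an angle with cosine \<open>r/2\<close> (2 and 3) and \<open>\<bar>\<tau>\<bar>/2\<close> (3 and 4), where
  a cosine of at least 1 means that they are tangent or disjoint; the others are orthogonal. Instead
  of a polyhedron theorem the proof uses the theorem of Tits on root systems of reflection groups:
  a product of reflections which is not the identity makes some simple root negative
  (\<open>nontrivial_word_makes_root_negative\<close>). It therefore moves any point of the open chamber out of
  the chamber, which gives a neighbourhood of the identity that meets the group trivially
  (\<open>discrete_reflection_group\<close>).

  Conversely, let the group be discrete and suppose \<open>r < 2\<close>, say \<open>r = 2 cos \<phi>\<close>. The powers of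
  \<open>h\<close> need not lie in the group, but the conjugates of \<open>g\<close> by them do, and that is enough
  for the inequality of Shimizu and Leutbecher: the lower left entry
  \<open>- 2 cot \<phi> sin (k \<phi>)\<close> of \<open>h\<^sup>k\<close> vanishes or has modulus at least 1. If \<open>\<pi>/\<phi>\<close> is not an integer,
  one of the two multiples of \<open>\<phi>\<close> next to \<open>\<pi>\<close> is within \<open>\<phi>/2\<close> of \<open>\<pi>\<close> and violates this
  (\<open>discrete_imp_mirror_bound\<close>).
\<close>

section \<open>Root positivity for linear reflection groups\<close>

text \<open>Chebyshev polynomials of the second kind, with the index shifted by one. They are the
  coefficients of the roots in the orbit of a simple root under a dihedral group, and also the
  entries of the powers of a matrix of trace \<open>2 * c\<close> and determinant 1.\<close>

fun cheb :: "real \<Rightarrow> nat \<Rightarrow> real" where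
  "cheb c 0 = 0"
| "cheb c (Suc 0) = 1"
| "cheb c (Suc (Suc k)) = 2 * c * cheb c (Suc k) - cheb c k"

lemma cheb_sin: "cheb (cos x) k * sin x = sin (real k * x)"
proof (induction "cos x" k rule: cheb.induct)
  case (3 k)
  have "sin (real (Suc (Suc k)) * x) = 2 * cos x * sin (real (Suc k) * x) - sin (real k * x)"
  proof -
    have e: "real (Suc (Suc k)) * x = real (Suc k) * x + x" "real k * x = real (Suc k) * x - x"
      by (simp_all add: algebra_simps)
    show ?thesis unfolding e sin_add sin_diff by (simp add: algebra_simps)
  qed
  then show ?case using 3 by (simp add: algebra_simps)
qed simp_all

lemma cheb_mono:
  assumes "c \<ge> 1"
  shows "0 \<le> cheb c k \<and> cheb c k \<le> cheb c (Suc k)"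
proof (induction k)
  case (Suc k)
  have "2 * cheb c (Suc k) \<le> 2 * c * cheb c (Suc k)"
    using assms Suc mult_right_mono[of 1 c "cheb c (Suc k)"] by auto
  then show ?case using Suc by simp
qed simp

lemma sin_pi_over_pos: "m \<ge> 2 \<Longrightarrow> sin (pi / real m) > 0" for m :: nat
  by (rule sin_gt_zero) (auto simp: field_simps)

lemma cheb_pi_over:
  assumes "m \<ge> 2"
  shows "cheb (cos (pi / real m)) m = 0" "cheb (cos (pi / real m)) (Suc m) = - 1"
    and "cheb (cos (pi / real m)) (m - 1) = 1"
    and "k \<le> m \<Longrightarrow> 0 \<le> cheb (cos (pi / real m)) k"
proof -
  let ?x = "pi / real m"
  have s: "sin ?x > 0" using assms by (rule sin_pi_over_pos)
  have m: "real m * ?x = pi" using assms by simp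
  show 0: "cheb (cos ?x) m = 0"
    using cheb_sin[of ?x m] s assms by (simp add: m split: if_splits)
  have "sin (real (Suc m) * ?x) = - sin ?x"
    using m by (simp add: distrib_right sin_add del: times_divide_eq_right)
  then show 1: "cheb (cos ?x) (Suc m) = - 1" using cheb_sin[of ?x "Suc m"] s
    by (metis mult_cancel_right mult_minus1 less_irrefl)
  obtain j where j: "m = Suc j" using assms by (cases m) auto
  show "cheb (cos ?x) (m - 1) = 1" using 0 1 j by simp
  show "0 \<le> cheb (cos ?x) k" if k: "k \<le> m"
  proof -
    have "real k * ?x \<le> pi" using k assms by (simp add: field_simps)
    then have "0 \<le> sin (real k * ?x)" by (intro sin_ge_zero) auto
    then show ?thesis using cheb_sin[of ?x k] s by (metis zero_le_mult_iff not_less)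
  qed
qed

text \<open>A Gram matrix of unit normals of hyperplanes whose dihedral angles are \<open>\<pi>/m\<close>, or which
  are tangent or disjoint. The form need not be positive, and several vectors may span a degenerate
  subspace, so the reflections act on the space with the simple roots as a basis and not on a
  quotient.\<close>

locale coxeter_form =
  fixes B :: "'i::finite \<Rightarrow> 'i \<Rightarrow> real"
  assumes sym: "B i j = B j i"
    and diag: "B i i = 1"
    and off_diag: "i \<noteq> j \<Longrightarrow> B i j \<le> - 1 \<or> (\<exists>m::nat. m \<ge> 2 \<and> B i j = - cos (pi / real m))"
begin

definition simple_root :: "'i \<Rightarrow> real^'i"
  where "simple_root i = axis i 1"

definition form :: "real^'i \<Rightarrow> 'i \<Rightarrow> real"
  where "form v i = (\<Sum>j\<in>UNIV. v $ j * B j i)"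

definition reflection :: "'i \<Rightarrow> real^'i \<Rightarrow> real^'i"
  where "reflection i v = v - (2 * form v i) *\<^sub>R simple_root i"

definition word :: "'i list \<Rightarrow> real^'i \<Rightarrow> real^'i"
  where "word xs v = foldr reflection xs v"

text \<open>Length is measured in the concrete linear group generated by the reflections; no abstract
  group presentation is involved.\<close>

definition reduced_word :: "'i list \<Rightarrow> bool"
  where "reduced_word xs \<longleftrightarrow> (\<forall>ys. word ys = word xs \<longrightarrow> length xs \<le> length ys)"

lemma word_simps [simp]:
  "word [] v = v" "word (x # xs) v = reflection x (word xs v)" "word (xs @ ys) v = word xs (word ys v)"
  by (simp_all add: word_def)

lemma form_add: "form (v + w) i = form v i + form w i"
  by (simp add: form_def algebra_simps sum.distrib)

lemma form_scale: "form (c *\<^sub>R v) i = c * form v i"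
  by (simp add: form_def algebra_simps sum_distrib_left)

lemma form_root: "form (simple_root j) i = B j i"
  by (simp add: form_def simple_root_def axis_def if_distrib [of "\<lambda>x. x * _"] sum.delta cong: if_cong)

lemma linear_reflection: "linear (reflection i)"
  by (rule linearI) (simp_all add: reflection_def form_add form_scale algebra_simps scaleR_add_left)

lemma linear_word: "linear (word xs)"
proof (induction xs)
  case Nil
  then show ?case by (auto intro: linearI)
next
  case (Cons x xs)
  then show ?case using linear_compose[OF Cons linear_reflection[of x]] by (simp add: comp_def)
qed

lemmas word_linear_simps =
  linear_add[OF linear_word] linear_cmul[OF linear_word] linear_neg[OF linear_word]
  linear_diff[OF linear_word]

lemma reflection_root: "reflection i (simple_root j) = simple_root j - (2 * B j i) *\<^sub>R simple_root i"
  by (simp add: reflection_def form_root)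

lemma reflection_root_same: "reflection i (simple_root i) = - simple_root i"
  by (simp add: reflection_root diag scaleR_2 flip: scaleR_left.minus)

lemma reflection_reflection [simp]: "reflection i (reflection i v) = v"
proof -
  have "reflection i (reflection i v) = reflection i v - (2 * form v i) *\<^sub>R reflection i (simple_root i)"
    by (simp add: reflection_def[of i v] linear_diff[OF linear_reflection] linear_cmul[OF linear_reflection])
  then show ?thesis by (simp add: reflection_root_same) (simp add: reflection_def)
qed

lemma reduced_append:
  assumes "reduced_word (xs @ ys)"
  shows "reduced_word xs" "reduced_word ys"
proof -
  show "reduced_word xs" unfolding reduced_word_def
  proof (intro allI impI)
    fix zs assume "word zs = word xs"
    then have "word (zs @ ys) = word (xs @ ys)" by (auto simp: fun_eq_iff)
    then have "length (xs @ ys) \<le> length (zs @ ys)" using assms unfolding reduced_word_def by blast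
    then show "length xs \<le> length zs" by simp
  qed
  show "reduced_word ys" unfolding reduced_word_def
  proof (intro allI impI)
    fix zs assume "word zs = word ys"
    then have "word (xs @ zs) = word (xs @ ys)" by (auto simp: fun_eq_iff)
    then have "length (xs @ ys) \<le> length (xs @ zs)" using assms unfolding reduced_word_def by blast
    then show "length ys \<le> length zs" by simp
  qed
qed

lemma ex_reduced: "\<exists>ys. reduced_word ys \<and> word ys = word xs"
proof -
  obtain ys where "word ys = word xs" "\<And>zs. word zs = word xs \<Longrightarrow> length ys \<le> length zs"
    using ex_has_least_nat[of "\<lambda>ys. word ys = word xs" xs length] by blast
  then show ?thesis unfolding reduced_word_def by metis
qed

lemma not_reduced_repeat: "\<not> reduced_word (x # x # xs)"
proof
  assume "reduced_word (x # x # xs)"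
  moreover have "word xs = word (x # x # xs)" by (simp add: fun_eq_iff)
  ultimately have "length (x # x # xs) \<le> length xs" unfolding reduced_word_def by blast
  then show False by simp
qed

fun alt :: "'i \<Rightarrow> 'i \<Rightarrow> nat \<Rightarrow> 'i list" where
  "alt s t 0 = []"
| "alt s t (Suc k) = (if even k then t else s) # alt s t k"

lemma length_alt [simp]: "length (alt s t k) = k"
  by (induction k) auto

lemma alt_snoc: "alt s t (Suc k) = alt t s k @ [t]"
  by (induction k) auto

lemma alt_split: "m \<le> k \<Longrightarrow> \<exists>zs. alt s t k = zs @ alt s t m"
proof (induction k)
  case (Suc k)
  then show ?case
  proof (cases "m = Suc k")
    case False
    then obtain zs where "alt s t k = zs @ alt s t m" using Suc by auto
    then show ?thesis by (intro exI[of _ "(if even k then t else s) # zs"]) simp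
  qed (auto intro: exI[of _ "[]"])
qed auto

lemma reduced_alternating:
  assumes "reduced_word ys" "set ys \<subseteq> {s, t}" "ys = [] \<or> last ys = t"
  shows "ys = alt s t (length ys)"
  using assms
proof (induction ys)
  case (Cons y ys)
  have "reduced_word ys" using reduced_append(2)[of "[y]" ys] Cons.prems by simp
  then have IH: "ys = alt s t (length ys)" using Cons by (cases ys) auto
  show ?case
  proof (cases "length ys")
    case 0
    then show ?thesis using Cons.prems by auto
  next
    case (Suc k)
    then have ys: "ys = (if even k then t else s) # alt s t k" using IH by simp
    have "y \<noteq> (if even k then t else s)"
      using Cons.prems(1) not_reduced_repeat[of y "alt s t k"] ys by metis
    then have "y = (if even (Suc k) then t else s)" using Cons.prems(2) by (auto split: if_splits)
    then show ?thesis using IH Suc by simp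
  qed
qed simp

text \<open>Two reflections span a dihedral group, in which every element is an alternating product;
  its effect on a simple root obeys the two-term recurrence of the Chebyshev polynomials.\<close>

lemma word_alt_root:
  "word (alt s t k) (simple_root s) =
     (if even k then cheb (- B s t) (Suc k) *\<^sub>R simple_root s + cheb (- B s t) k *\<^sub>R simple_root t
      else cheb (- B s t) k *\<^sub>R simple_root s + cheb (- B s t) (Suc k) *\<^sub>R simple_root t)"
proof (induction k)
  case (Suc k)
  have ts: "reflection t (simple_root s) = simple_root s - (2 * B s t) *\<^sub>R simple_root t"
    and st: "reflection s (simple_root t) = simple_root t - (2 * B s t) *\<^sub>R simple_root s"
    using sym[of s t] by (simp_all add: reflection_root)
  show ?case
    by (simp add: Suc ts st linear_add[OF linear_reflection] linear_cmul[OF linear_reflection]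
        reflection_root_same scaleR_diff_left algebra_simps)
qed simp

lemma word_fixed: "(\<And>x. x \<in> set xs \<Longrightarrow> form v x = 0) \<Longrightarrow> word xs v = v"
  by (induction xs) (auto simp: reflection_def)

lemma set_alt: "set (alt s t k) \<subseteq> {s, t}"
  by (induction k) auto

lemma braid_root:
  assumes B: "B s t = - cos (pi / real m)" and m: "m \<ge> 2"
  shows "word (alt s t m) (simple_root s) = - (if even m then simple_root s else simple_root t)"
    and "word (alt s t m) (simple_root t) = - (if even m then simple_root t else simple_root s)"
proof -
  have c: "- B s t = cos (pi / real m)" "- B t s = cos (pi / real m)" using B sym[of s t] by auto
  show "word (alt s t m) (simple_root s) = - (if even m then simple_root s else simple_root t)"
    by (simp add: word_alt_root c cheb_pi_over[OF m])
  obtain j where j: "m = Suc j" using m by (cases m) auto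
  have "word (alt s t m) (simple_root t) = - word (alt t s j) (simple_root t)"
    unfolding j alt_snoc by (simp add: reflection_root_same word_linear_simps)
  also have "\<dots> = - (if even m then simple_root t else simple_root s)"
    using cheb_pi_over[OF m] unfolding j by (simp add: word_alt_root c[unfolded j])
  finally show "word (alt s t m) (simple_root t) = - (if even m then simple_root t else simple_root s)" .
qed

text \<open>The braid relation holds on the two roots by \<open>braid_root\<close>. For \<open>m \<ge> 2\<close> the form is
  nondegenerate on their span, so every vector is the sum of one in the span and one that both
  reflections fix.\<close>

lemma braid:
  assumes B: "B s t = - cos (pi / real m)" and m: "m \<ge> 2"
  shows "word (alt s t m) = word (alt t s m)"
proof
  fix v
  define c where "c = B s t"
  have "sin (pi / real m) ^ 2 > 0" using sin_pi_over_pos[OF m] by simp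
  then have D: "1 - c\<^sup>2 \<noteq> 0" by (simp add: c_def B sin_squared_eq)
  define a where "a = (form v s - c * form v t) / (1 - c\<^sup>2)"
  define b where "b = (form v t - c * form v s) / (1 - c\<^sup>2)"
  define u where "u = v - (a *\<^sub>R simple_root s + b *\<^sub>R simple_root t)"
  have Bts: "B t s = c" "B s t = c" using sym[of s t] by (simp_all add: c_def)
  have v: "v = a *\<^sub>R simple_root s + b *\<^sub>R simple_root t + u" by (simp add: u_def)
  have "form v s = a + b * c" "form v t = a * c + b"
    using D by (simp_all add: a_def b_def divide_simps) (simp_all add: power2_eq_square algebra_simps)
  moreover have "form v s = a + b * c + form u s" "form v t = a * c + b + form u t"
    by (subst v, simp add: form_add form_scale form_root diag Bts)+
  ultimately have "form u s = 0" "form u t = 0" by auto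
  then have u: "word (alt s t m) u = u" "word (alt t s m) u = u"
    using set_alt by (intro word_fixed; fastforce)+
  have B': "B t s = - cos (pi / real m)" using B sym[of s t] by simp
  show "word (alt s t m) v = word (alt t s m) v"
    by (subst (1 2) v)
      (simp add: word_linear_simps u braid_root[OF B m] braid_root[OF B' m])
qed

text \<open>Such a word alternates and ends in \<open>t\<close>. In the case of an angle \<open>\<pi>/m\<close> it has fewer than \<open>m\<close>
  letters, since otherwise the braid relation would rewrite it to a word ending in \<open>s\<close>, which
  cancels against the appended \<open>s\<close>. In this range the Chebyshev coefficients
  \<open>sin (k \<pi>/m) / sin (\<pi>/m)\<close> are nonnegative.\<close>

lemma dihedral_positive:
  assumes st: "s \<noteq> t" and ys: "reduced_word ys" "set ys \<subseteq> {s, t}"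
    and up: "\<And>zs. word zs = word (ys @ [s]) \<Longrightarrow> length ys \<le> length zs"
  shows "\<exists>a b. a \<ge> 0 \<and> b \<ge> 0 \<and> word ys (simple_root s) = a *\<^sub>R simple_root s + b *\<^sub>R simple_root t"
proof -
  have shorten: False if "ys = zs @ [s]" for zs
    using up[of zs] that by (simp add: fun_eq_iff)
  have "ys = [] \<or> last ys = t"
  proof (rule ccontr)
    assume "\<not> (ys = [] \<or> last ys = t)"
    then have "ys \<noteq> []" "last ys = s" using ys(2) last_in_set[of ys] by blast+
    then show False using shorten[of "butlast ys"] by (metis append_butlast_last_id)
  qed
  then have alt: "ys = alt s t (length ys)" using reduced_alternating[OF ys] by blast
  define k where "k = length ys"
  have ysk: "ys = alt s t k" using alt by (simp add: k_def)
  have "0 \<le> cheb (- B s t) k \<and> 0 \<le> cheb (- B s t) (Suc k)"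
    using off_diag[OF st]
  proof
    assume "B s t \<le> - 1"
    then show ?thesis using cheb_mono[of "- B s t" k] by auto
  next
    assume "\<exists>m::nat. m \<ge> 2 \<and> B s t = - cos (pi / real m)"
    then obtain m :: nat where m: "m \<ge> 2" "B s t = - cos (pi / real m)" by blast
    have "k < m"
    proof (rule ccontr)
      assume "\<not> k < m"
      then obtain zs where zs: "ys = zs @ alt s t m" using alt_split[of m k s t] ysk by auto
      obtain j where j: "m = Suc j" using m by (cases m) auto
      have "word ys = word ((zs @ alt s t j) @ [s])"
        unfolding zs using braid[OF m(2,1)] unfolding j alt_snoc[of t s] by (auto simp: fun_eq_iff)
      then have "word (zs @ alt s t j) = word (ys @ [s])" by (auto simp: fun_eq_iff)
      from up[OF this] show False unfolding zs j by simp
    qed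
    then show ?thesis using m cheb_pi_over(4)[OF m(1)] by simp
  qed
  then show ?thesis unfolding ysk word_alt_root by (auto split: if_splits)
qed

text \<open>The theorem of Tits: if appending \<open>s\<close> does not shorten a word, the word keeps the root \<open>s\<close>
  positive. Split off on the right as many letters \<open>s, t\<close> as possible, where \<open>t\<close> is the last letter.
  The split-off part takes the root \<open>s\<close> to a nonnegative combination of the roots \<open>s\<close> and \<open>t\<close>, and
  the shorter remaining part keeps both positive by induction.\<close>

theorem root_positive:
  assumes "reduced_word xs" "\<And>zs. word zs = word (xs @ [s]) \<Longrightarrow> length xs \<le> length zs"
  shows "0 \<le> word xs (simple_root s) $ i"
  using assms
proof (induction "length xs" arbitrary: xs s i rule: less_induct)
  case less
  show ?case
  proof (cases "xs = []")
    case True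
    then show ?thesis by (simp add: simple_root_def axis_def)
  next
    case False
    define t where "t = last xs"
    have xs: "xs = butlast xs @ [t]" using False by (simp add: t_def)
    have st: "s \<noteq> t"
    proof
      assume "s = t"
      then have "word (butlast xs) = word (xs @ [s])" by (subst xs) (simp add: fun_eq_iff)
      then have "length xs \<le> length (butlast xs)" by (rule less.prems(2))
      then show False using False by (cases "length xs") auto
    qed
\<comment> \<open>A factorization into a prefix and a word in \<open>s, t\<close>, of total length that of \<open>xs\<close>.\<close>
    define P where "P = (\<lambda>p. word (fst p @ snd p) = word xs \<and> set (snd p) \<subseteq> {s, t} \<and>
      length (fst p) + length (snd p) = length xs)"
    have P0: "P (butlast xs, [t])" using xs by (simp add: P_def False flip: xs)
    obtain p where p: "P p" "\<And>q. P q \<Longrightarrow> length (fst p) \<le> length (fst q)"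
      using ex_has_least_nat[of P "(butlast xs, [t])" "length \<circ> fst"] P0 unfolding comp_def by metis
    obtain us ys where us: "p = (us, ys)" by (cases p)
    have w: "word (us @ ys) = word xs" "set ys \<subseteq> {s, t}" "length us + length ys = length xs"
      using p(1) by (auto simp: P_def us)
    have wv: "word us (word ys v) = word xs v" for v using fun_cong[OF w(1), of v] by simp
    have red: "reduced_word (us @ ys)" using less.prems(1) w by (auto simp: reduced_word_def)
    have shorter: "length us < length xs" using p(2)[OF P0] False us by (simp add: less_eq_Suc_le flip: length_0_conv)
\<comment> \<open>If appending \<open>s\<close> or \<open>t\<close> shortened the prefix, moving this letter to the suffix would contradict
      the minimality of the prefix.\<close>
    have pos: "0 \<le> word us (simple_root x) $ i" if x: "x \<in> {s, t}" for x i
    proof (rule less.hyps[OF shorter])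
      show "reduced_word us" using red by (rule reduced_append)
      fix zs assume zs: "word zs = word (us @ [x])"
      show "length us \<le> length zs"
      proof (rule ccontr)
        assume lt: "\<not> length us \<le> length zs"
        have eq: "word (zs @ x # ys) = word xs"
          using zs by (auto simp: fun_eq_iff wv)
        have "length xs \<le> length (zs @ x # ys)"
          using less.prems(1) eq unfolding reduced_word_def by blast
        then have "P (zs, x # ys)" using lt eq w x by (auto simp: P_def)
        then show False using p(2)[of "(zs, x # ys)"] lt us by simp
      qed
    qed
    have "\<exists>a b. a \<ge> 0 \<and> b \<ge> 0 \<and> word ys (simple_root s) = a *\<^sub>R simple_root s + b *\<^sub>R simple_root t"
    proof (rule dihedral_positive[OF st _ w(2)])
      show "reduced_word ys" using red by (rule reduced_append)
      fix zs assume zs: "word zs = word (ys @ [s])"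
      have "word (us @ zs) = word (xs @ [s])" using zs by (auto simp: fun_eq_iff wv)
      then have "length xs \<le> length (us @ zs)" by (rule less.prems(2))
      then show "length ys \<le> length zs" using w(3) by simp
    qed
    then obtain a b where ab: "a \<ge> 0" "b \<ge> 0" "word ys (simple_root s) = a *\<^sub>R simple_root s + b *\<^sub>R simple_root t" by blast
    have "word xs (simple_root s) = a *\<^sub>R word us (simple_root s) + b *\<^sub>R word us (simple_root t)"
      by (simp add: wv[symmetric] ab(3) word_linear_simps)
    then show ?thesis using ab pos[of s i] pos[of t i] by simp
  qed
qed

corollary nontrivial_word_makes_root_negative:
  assumes "word xs \<noteq> id"
  shows "\<exists>s. \<forall>i. word xs (simple_root s) $ i \<le> 0"
proof -
  obtain ys where ys: "reduced_word ys" "word ys = word xs" using ex_reduced by blast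
  have "ys \<noteq> []" using assms ys by (auto simp: fun_eq_iff)
  define zs s where "zs = butlast ys" and "s = last ys"
  have y: "ys = zs @ [s]" using \<open>ys \<noteq> []\<close> by (simp add: zs_def s_def)
  have "reduced_word zs" using ys(1) reduced_append(1) y by blast
  moreover have "length zs \<le> length us" if "word us = word (zs @ [s])" for us
    using ys(1) that unfolding y reduced_word_def by force
  ultimately have "0 \<le> word zs (simple_root s) $ i" for i by (rule root_positive)
  moreover have "word xs (simple_root s) = - word zs (simple_root s)"
    using ys(2) y by (metis word_simps reflection_root_same word_linear_simps(3))
  ultimately show ?thesis by (intro exI[of _ s]) simp
qed

lemma word_rev [simp]: "word (rev xs) (word xs v) = v"
  by (induction xs arbitrary: v) simp_all

lemma reflection_nth: "reflection i v $ j = (if j = i then v $ i - 2 * form v i else v $ j)"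
  by (simp add: reflection_def simple_root_def axis_def)

end

section \<open>Two-by-two matrices and their classes\<close>

definition mat2 :: "complex \<Rightarrow> complex \<Rightarrow> complex \<Rightarrow> complex \<Rightarrow> complex^2^2"
  where "mat2 a b c d = vector [vector [a, b], vector [c, d]]"

text \<open>The adjugate, which is the inverse for determinant 1.\<close>

definition adj2 :: "complex^2^2 \<Rightarrow> complex^2^2"
  where "adj2 A = mat2 (A$2$2) (- A$1$2) (- A$2$1) (A$1$1)"

text \<open>The conjugate transpose.\<close>

definition ctrans :: "complex^2^2 \<Rightarrow> complex^2^2"
  where "ctrans A = mat2 (cnj (A$1$1)) (cnj (A$2$1)) (cnj (A$1$2)) (cnj (A$2$2))"

lemma mat2_nth [simp]:
  "mat2 a b c d $ 1 $ 1 = a" "mat2 a b c d $ 1 $ 2 = b"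
  "mat2 a b c d $ 2 $ 1 = c" "mat2 a b c d $ 2 $ 2 = d"
  by (simp_all add: mat2_def)

lemma mat2_eta: "A = mat2 (A$1$1) (A$1$2) (A$2$1) (A$2$2)"
  by (simp add: vec_eq_iff forall_2)

lemma mat2_cases [cases type]: obtains a b c d where "A = mat2 a b c d"
  using mat2_eta by blast

lemma mat2_eq_iff [simp]: "mat2 a b c d = mat2 a' b' c' d' \<longleftrightarrow> a = a' \<and> b = b' \<and> c = c' \<and> d = d'"
  by (auto simp: vec_eq_iff forall_2)

lemma mat2_mult [simp]:
  "mat2 a b c d ** mat2 a' b' c' d' =
     mat2 (a * a' + b * c') (a * b' + b * d') (c * a' + d * c') (c * b' + d * d')"
  by (simp add: vec_eq_iff forall_2 matrix_matrix_mult_def sum_2)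

lemma mat2_arith [simp]:
  "mat2 a b c d + mat2 a' b' c' d' = mat2 (a + a') (b + b') (c + c') (d + d')"
  "- mat2 a b c d = mat2 (- a) (- b) (- c) (- d)"
  by (simp_all add: vec_eq_iff forall_2)

lemma mat2_simps [simp]:
  "det (mat2 a b c d) = a * d - b * c" "trace (mat2 a b c d) = a + d"
  "adj2 (mat2 a b c d) = mat2 d (- b) (- c) a"
  "ctrans (mat2 a b c d) = mat2 (cnj a) (cnj c) (cnj b) (cnj d)"
  by (simp_all add: det_2 trace_def sum_2 adj2_def ctrans_def)

lemma mat_1_mat2: "(mat 1 :: complex^2^2) = mat2 1 0 0 1"
  by (simp add: vec_eq_iff forall_2 mat_def)

lemma adj2_mult: "adj2 (A ** B) = adj2 B ** adj2 A"
  by (cases A; cases B) (simp add: algebra_simps)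

lemma adj2_more [simp]: "adj2 (adj2 A) = A" "det (adj2 A) = det A" "adj2 (- A) = - adj2 A"
  "adj2 (mat 1) = mat 1"
  by (cases A; simp add: mat_1_mat2)+

lemma adj2_inverse:
  assumes "det A = 1" shows "A ** adj2 A = mat 1" "adj2 A ** A = mat 1"
  using assms by (cases A; simp add: mat_1_mat2 algebra_simps)+

lemma adj2_cancel:
  assumes "det A = 1"
  shows "A ** (adj2 A ** Z) = Z" "adj2 A ** (A ** Z) = Z"
  using adj2_inverse[OF assms] by (simp_all add: matrix_mul_assoc)

lemma ctrans_mult: "ctrans (A ** B) = ctrans B ** ctrans A"
  by (cases A; cases B) (simp add: algebra_simps)

lemma ctrans_more [simp]: "ctrans (ctrans A) = A" "det (ctrans A) = cnj (det A)"
  "ctrans (- A) = - ctrans A" "ctrans (mat 1) = mat 1"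
  by (cases A; simp add: mat_1_mat2)+

definition conj_by :: "complex^2^2 \<Rightarrow> complex^2^2 \<Rightarrow> complex^2^2"
  where "conj_by q A = adj2 q ** A ** q"

lemma conj_by_hom:
  assumes "det q = 1"
  shows "conj_by q (A ** B) = conj_by q A ** conj_by q B" "conj_by q (mat 1) = mat 1"
    "conj_by q (- A) = - conj_by q A" "conj_by q (adj2 A) = adj2 (conj_by q A)"
    "det (conj_by q A) = det A" "trace (conj_by q A) = trace A"
proof -
  show "conj_by q (A ** B) = conj_by q A ** conj_by q B"
    by (simp add: conj_by_def adj2_cancel[OF assms] flip: matrix_mul_assoc)
  show "conj_by q (mat 1) = mat 1" by (simp add: conj_by_def adj2_inverse[OF assms])
  show "conj_by q (- A) = - conj_by q A" by (simp add: conj_by_def neg_mult_2)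
  show "conj_by q (adj2 A) = adj2 (conj_by q A)" by (simp add: conj_by_def adj2_mult matrix_mul_assoc)
  show "det (conj_by q A) = det A" by (simp add: conj_by_def det_mul assms)
  have "trace (conj_by q A) = trace (q ** (adj2 q ** A))"
    unfolding conj_by_def by (subst trace_mul_sym) simp
  then show "trace (conj_by q A) = trace A" by (simp add: adj2_cancel[OF assms])
qed

lemma conj_by_inverse:
  assumes "det q = 1"
  shows "conj_by q (conj_by (adj2 q) A) = A" "conj_by (adj2 q) (conj_by q A) = A"
  by (simp_all add: conj_by_def adj2_cancel[OF assms] adj2_inverse[OF assms] flip: matrix_mul_assoc)

definition psl :: "complex^2^2 \<Rightarrow> (complex^2^2) set"
  where "psl A = {A, - A}"

lemma carrier_SL2C: "A \<in> carrier SL2C \<longleftrightarrow> det A = 1"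
  by (simp add: SL2C_def)

lemma PSL2C_cases:
  assumes "x \<in> carrier PSL2C" obtains A where "det A = 1" "x = psl A"
  using assms by (auto simp: carrier_PSL2C carrier_SL2C psl_def)

lemma psl_carrier: "det A = 1 \<Longrightarrow> psl A \<in> carrier PSL2C"
  by (auto simp: carrier_PSL2C carrier_SL2C psl_def)

lemma psl_self: "A \<in> psl A" by (simp add: psl_def)

lemma psl_eq_iff: "psl A = psl B \<longleftrightarrow> A = B \<or> A = - B"
  by (auto simp: psl_def doubleton_eq_iff)

lemma psl_member: "x \<in> carrier PSL2C \<Longrightarrow> A \<in> x \<Longrightarrow> det A = 1 \<and> x = psl A"
  using PSL2C_lifts by (auto simp: psl_def carrier_SL2C)

lemma psl_one: "\<one>\<^bsub>PSL2C\<^esub> = psl (mat 1)"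
  by (simp add: PSL2C_def FactGroup_def psl_def)

lemma inv_SL2C: "det A = 1 \<Longrightarrow> inv\<^bsub>SL2C\<^esub> A = adj2 A"
  by (rule group.inv_equality[OF group_SL2C]) (simp_all add: SL2C_def adj2_inverse)

lemma psl_mult:
  assumes "det A = 1" "det B = 1"
  shows "psl A \<otimes>\<^bsub>PSL2C\<^esub> psl B = psl (A ** B)"
proof -
  have "A \<in> carrier SL2C" "B \<in> carrier SL2C" using assms by (simp_all add: carrier_SL2C)
  then have "psl A \<otimes>\<^bsub>PSL2C\<^esub> psl B = {mat 1, - mat 1} #>\<^bsub>SL2C\<^esub> (A \<otimes>\<^bsub>SL2C\<^esub> B)"
    using normal.rcos_sum[OF normal_signs, of A B]
    by (simp add: PSL2C_def FactGroup_def psl_def coset_signs)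
  then show ?thesis by (simp add: coset_signs psl_def) (simp add: SL2C_def)
qed

lemma psl_inv:
  assumes "det A = 1"
  shows "inv\<^bsub>PSL2C\<^esub> (psl A) = psl (adj2 A)"
  using assms by (intro group.inv_equality[OF group_PSL2C])
    (simp_all add: psl_mult psl_carrier adj2_inverse psl_one)

primrec mpow :: "complex^2^2 \<Rightarrow> nat \<Rightarrow> complex^2^2" where
  "mpow A 0 = mat 1"
| "mpow A (Suc n) = mpow A n ** A"

lemma det_mpow: "det A = 1 \<Longrightarrow> det (mpow A n) = 1"
  by (induction n) (simp_all add: det_mul)

lemma psl_pow: "det A = 1 \<Longrightarrow> psl A [^]\<^bsub>PSL2C\<^esub> n = psl (mpow A n)"
  by (induction n) (simp_all add: psl_one psl_mult det_mpow)

lemma conj_by_mpow: "det q = 1 \<Longrightarrow> conj_by q (mpow A n) = mpow (conj_by q A) n"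
  by (induction n) (simp_all add: conj_by_hom)

lemma beta_psl: "det A = 1 \<Longrightarrow> beta (psl A) = (trace A)\<^sup>2 - 4"
  by (rule beta_any_lift) (auto simp: psl_carrier psl_self)

lemma gamma_psl:
  assumes "det A = 1" "det B = 1"
  shows "gamma (psl A) (psl B) = trace (A ** B ** adj2 A ** adj2 B) - 2"
  using gamma_any_lift[OF psl_carrier[OF assms(1)] psl_self psl_carrier[OF assms(2)] psl_self] assms
  by (simp add: inv_SL2C) (simp add: SL2C_def)

text \<open>Besides being a subgroup of \<open>SL2C\<close>, closure under sign makes it a union of classes.\<close>

definition matrix_group :: "(complex^2^2) set \<Rightarrow> bool"
  where "matrix_group L \<longleftrightarrow> mat 1 \<in> L \<and> (\<forall>A\<in>L. det A = 1 \<and> - A \<in> L \<and> adj2 A \<in> L) \<and>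
    (\<forall>A\<in>L. \<forall>B\<in>L. A ** B \<in> L)"

text \<open>To show a property of all elements of a generated group it suffices to exhibit a matrix
  group with that property containing one lift of each generator.\<close>

lemma generate_lifts_subset:
  assumes AB: "det A = 1" "det B = 1" and L: "matrix_group L" "A \<in> L" "B \<in> L"
    and x: "x \<in> generate PSL2C {psl A, psl B}"
  shows "x \<subseteq> L"
  using x
proof (induction rule: generate.induct)
  case one
  then show ?case using L by (auto simp: psl_one psl_def matrix_group_def)
next
  case (incl x)
  then show ?case using L by (auto simp: psl_def matrix_group_def)
next
  case (inv x)
  then show ?case using L AB by (auto simp: psl_inv) (auto simp: psl_def matrix_group_def)
next
  case (eng x y)
  have car: "generate PSL2C {psl A, psl B} \<subseteq> carrier PSL2C"
    using AB by (intro group.generate_incl[OF group_PSL2C]) (auto simp: psl_carrier)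
  obtain Z where Z: "det Z = 1" "x = psl Z" using eng car by (blast elim: PSL2C_cases)
  obtain Y where Y: "det Y = 1" "y = psl Y" using eng car by (blast elim: PSL2C_cases)
  have "Z ** Y \<in> L" using eng Z Y psl_self L(1) unfolding matrix_group_def by blast
  then show ?case using Z Y L(1) by (auto simp: psl_mult) (auto simp: psl_def matrix_group_def)
qed

lemma matrix_group_lifts:
  assumes "subgroup \<Gamma> PSL2C"
  shows "matrix_group (\<Union>\<Gamma>)"
proof -
  interpret subgroup \<Gamma> PSL2C by fact
  have mem: "Z \<in> \<Union>\<Gamma> \<longleftrightarrow> det Z = 1 \<and> psl Z \<in> \<Gamma>" for Z
    using psl_member psl_self subset by blast
  have neg: "psl (- Z) = psl Z" for Z by (auto simp: psl_def)
  show ?thesis unfolding matrix_group_def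
  proof (intro conjI ballI)
    show "mat 1 \<in> \<Union>\<Gamma>" using one_closed by (simp only: mem psl_one det_I)
  next
    fix A assume A: "A \<in> \<Union>\<Gamma>"
    then show "det A = 1" "- A \<in> \<Union>\<Gamma>" by (simp_all only: mem det_neg_2 neg)
    show "adj2 A \<in> \<Union>\<Gamma>"
      using A m_inv_closed[of "psl A"] by (simp only: mem psl_inv adj2_more)
    fix B assume B: "B \<in> \<Union>\<Gamma>"
    show "A ** B \<in> \<Union>\<Gamma>"
      using A B m_closed[of "psl A" "psl B"] by (simp only: mem psl_mult det_mul mult_1)
  qed
qed

lemma matrix_group_conj:
  assumes q: "det q = 1" and "matrix_group L"
  shows "matrix_group (conj_by q ` L)"
  using assms(2) unfolding matrix_group_def
  by (simp add: conj_by_hom(5)[OF q] flip: conj_by_hom(1,3,4)[OF q])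
    (metis conj_by_hom(2)[OF q] image_eqI)

section \<open>Points and planes of hyperbolic space as Hermitian matrices\<close>

text \<open>Points of the upper half-space correspond to the positive definite Hermitian matrices of
  determinant 1, and the Poincare extension becomes the linear action \<open>H \<mapsto> A H A\<^sup>*\<close>. This makes the
  homomorphism property evident, which is hidden by the explicit formula.\<close>

definition herm_point :: "complex \<times> real \<Rightarrow> complex^2^2"
  where "herm_point = (\<lambda>(z, t). mat2 ((z * cnj z + of_real (t\<^sup>2)) / of_real t) (z / of_real t) (cnj z / of_real t) (1 / of_real t))"

definition act_herm :: "complex^2^2 \<Rightarrow> complex^2^2 \<Rightarrow> complex^2^2"
  where "act_herm A H = A ** H ** ctrans A"

lemma act_herm_mult: "act_herm (A ** B) H = act_herm A (act_herm B H)"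
  by (simp add: act_herm_def ctrans_mult matrix_mul_assoc)

lemma act_herm_one [simp]: "act_herm (mat 1) H = H"
  by (simp add: act_herm_def)

lemma act_herm_neg [simp]: "act_herm (- A) H = act_herm A H"
  by (simp add: act_herm_def neg_mult_2)

lemma act_herm_adj2:
  assumes "det A = 1"
  shows "act_herm (adj2 A) (act_herm A H) = H" "act_herm A (act_herm (adj2 A) H) = H"
  by (simp_all add: adj2_inverse[OF assms] flip: act_herm_mult)

lemma det_act_herm [simp]: "det A = 1 \<Longrightarrow> det (act_herm A H) = det H"
  by (simp add: act_herm_def det_mul)

lemma act_herm_add: "act_herm A (H + K) = act_herm A H + act_herm A K"
  by (cases A; cases H; cases K) (simp add: act_herm_def algebra_simps)

lemma herm_point_inject:
  assumes "p \<in> H3" "p' \<in> H3" "herm_point p = herm_point p'"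
  shows "p = p'"
  using assms by (auto simp: H3_def herm_point_def)

text \<open>The determinant fixes the upper left entry, so only the right column of \<open>A H A\<^sup>*\<close> has to be
  computed below.\<close>

lemma hermitian_det_one:
  assumes "det (mat2 a b (cnj b) (of_real w)) = 1" "w > 0"
  shows "mat2 a b (cnj b) (of_real w) = herm_point (b / of_real w, 1 / w)"
proof -
  have "a * of_real w = 1 + b * cnj b"
    using assms(1) by (simp add: algebra_simps)
  then show ?thesis using assms(2)
    by (simp add: herm_point_def field_simps power2_eq_square)
qed

lemma act_point:
  assumes x: "x \<in> carrier PSL2C" and A: "A \<in> x" and p: "p \<in> H3"
  shows "act_herm A (herm_point p) = herm_point (act_H3 x p)" "act_H3 x p \<in> H3"
proof -
  obtain z t where zt: "p = (z, t)" "t > 0" using p by (auto simp: H3_def)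
  define L where "L = lift x"
  have L: "det L = 1" using psl_member[OF x lift_in[OF x]] by (simp add: L_def)
  have AL: "act_herm A = act_herm L"
    using lift_cases[OF x A] by (auto simp: L_def fun_eq_iff)
  obtain a b c d where abcd: "L = mat2 a b c d" by (cases L)
  have det: "a * d - b * c = 1" using L abcd by simp
  define N where "N = (cmod (c * z + d))\<^sup>2 + (cmod c)\<^sup>2 * t\<^sup>2"
  define Y where "Y = (a * z + b) * cnj (c * z + d) + a * cnj c * of_real (t\<^sup>2)"
  have act: "act_H3 x p = (Y / of_real N, t / N)"
    using abcd by (simp add: act_H3_def zt N_def Y_def L_def Let_def)
  have "c * z + d \<noteq> 0" if "c = 0" using that det by auto
  then have N: "N > 0" using zt(2)
    by (cases "c = 0") (auto simp: N_def intro!: add_nonneg_pos mult_pos_pos)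
  show "act_H3 x p \<in> H3" using N zt(2) by (simp add: act H3_def)
  have t0: "complex_of_real t \<noteq> 0" using zt by simp
  have "det (herm_point p) = 1" using t0
    by (simp add: zt herm_point_def add_divide_distrib power2_eq_square)
  then have det1: "det (act_herm L (herm_point p)) = 1" using L by simp
  have NC: "of_real N = (c * z + d) * cnj (c * z + d) + c * cnj c * of_real t ^ 2"
    unfolding N_def of_real_add of_real_mult complex_norm_square by (simp only: of_real_power)
  have "\<exists>a'. act_herm L (herm_point p) = mat2 a' (Y / t) (cnj (Y / t)) (of_real (N / t))"
    unfolding act_herm_def abcd herm_point_def zt
    by (simp add: divide_inverse NC Y_def algebra_simps power2_eq_square)
  then obtain a' where a': "act_herm L (herm_point p) = mat2 a' (Y / t) (cnj (Y / t)) (of_real (N / t))"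
    by blast
  then have "act_herm L (herm_point p) = herm_point ((Y / t) / of_real (N / t), 1 / (N / t))"
    using hermitian_det_one[of a' "Y / t" "N / t"] det1 N zt(2) by simp
  then show "act_herm A (herm_point p) = herm_point (act_H3 x p)"
    using t0 unfolding AL act by simp
qed

lemma act_point_psl:
  assumes "det A = 1" "p \<in> H3"
  shows "act_herm A (herm_point p) = herm_point (act_H3 (psl A) p)" "act_H3 (psl A) p \<in> H3"
  using act_point[OF psl_carrier[OF assms(1)] psl_self assms(2)] by auto

lemma act_H3_psl_mult:
  assumes "det A = 1" "det B = 1" "p \<in> H3"
  shows "act_H3 (psl A) (act_H3 (psl B) p) = act_H3 (psl (A ** B)) p"
proof (rule herm_point_inject)
  show "herm_point (act_H3 (psl A) (act_H3 (psl B) p)) = herm_point (act_H3 (psl (A ** B)) p)"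
    using assms by (metis act_herm_mult act_point_psl det_mul mult_1)
qed (use assms in \<open>simp_all add: act_point_psl det_mul\<close>)

text \<open>A matrix fixing the point of the identity matrix is unitary, and then it commutes with the
  matrices of all points; a diagonal and a nondiagonal one suffice to make it scalar.\<close>

lemma act_herm_faithful:
  assumes A: "det A = 1" and fix_point: "\<And>p. p \<in> H3 \<Longrightarrow> act_herm A (herm_point p) = herm_point p"
  shows "A = mat 1 \<or> A = - mat 1"
proof -
  have "herm_point (0, 1) = mat 1" by (simp add: herm_point_def mat_1_mat2)
  then have "A ** ctrans A = mat 1"
    using fix_point[of "(0, 1)"] by (simp add: H3_def act_herm_def)
  then have "ctrans A = adj2 A"
    using adj2_cancel(2)[OF A, of "ctrans A"] by simp
  then have comm: "A ** herm_point p = herm_point p ** A" if "p \<in> H3" for p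
    using fix_point[OF that] adj2_inverse[OF A]
    by (metis act_herm_def matrix_mul_assoc matrix_mul_rid)
  obtain a b c d where A': "A = mat2 a b c d" by (cases A)
  have "herm_point (0, 2) = mat2 2 0 0 (1 / 2)" "herm_point (1, 1) = mat2 2 1 1 1"
    by (simp_all add: herm_point_def)
  then have "A ** mat2 2 0 0 (1 / 2) = mat2 2 0 0 (1 / 2) ** A" "A ** mat2 2 1 1 1 = mat2 2 1 1 1 ** A"
    using comm[of "(0, 2)"] comm[of "(1, 1)"] by (simp_all add: H3_def)
  then have "b * (1 / 2) = 2 * b" "c * 2 = 1 / 2 * c" "a + b = 2 * b + d"
    unfolding A' mat2_mult mat2_eq_iff by (simp_all only: mult_zero_left mult_zero_right add_0_left add_0_right mult_1_left mult_1_right)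
  then have "b = 0" "c = 0" "a = d" by auto
  then show ?thesis using A by (auto simp: A' mat_1_mat2 power2_eq_1_iff simp flip: power2_eq_square)
qed

text \<open>Up to a factor this is the polarization of the determinant.\<close>

definition pairing :: "complex^2^2 \<Rightarrow> complex^2^2 \<Rightarrow> complex"
  where "pairing H K = det (H + K) - det H - det K"

lemma pairing_mat2: "pairing (mat2 a b c d) (mat2 a' b' c' d') = a * d' + d * a' - b * c' - c * b'"
  by (simp add: pairing_def algebra_simps)

lemma pairing_act_herm: "det A = 1 \<Longrightarrow> pairing (act_herm A H) (act_herm A K) = pairing H K"
  by (simp add: pairing_def flip: act_herm_add)

text \<open>Hermitian matrices of negative determinant are the unit normals, up to a factor, of the
  hyperbolic planes.\<close>

definition plane_of :: "complex^2^2 \<Rightarrow> (complex \<times> real) set"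
  where "plane_of H = {p \<in> H3. pairing H (herm_point p) = 0}"

lemma hyperbolic_plane_plane_of:
  assumes H: "ctrans H = H" and neg: "Re (det H) < 0"
  shows "hyperbolic_plane (plane_of H)"
proof -
  obtain a y b e where aybe: "H = mat2 a y b e" by (cases H)
  then have c: "cnj a = a" "cnj y = b" "cnj e = e" using H by (auto simp del: complex_cnj_cancel_iff)
  define x w where "x = Re a" and "w = Re e"
  have "of_real x = a" "of_real w = e"
    unfolding x_def w_def using c by (simp_all add: Reals_cnj_iff)
  then have H': "H = mat2 (of_real x) y (cnj y) (of_real w)" using c by (simp add: aybe)
  have neg': "x * w < (cmod y)\<^sup>2" using neg unfolding H'
    by (simp add: cmod_power2) (simp add: power2_eq_square)
  have pt: "p \<in> plane_of H \<longleftrightarrow> (case p of (z, t) \<Rightarrow>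
      t > 0 \<and> x + w * ((cmod z)\<^sup>2 + t\<^sup>2) - 2 * (y \<bullet> z) = 0)" for p
  proof -
    obtain z t where p: "p = (z, t)" by (cases p)
    have inner: "y * cnj z + cnj y * z = of_real (2 * (y \<bullet> z))"
      by (simp add: complex_eq_iff inner_complex_def algebra_simps)
    have "pairing H (herm_point p) = (of_real x + of_real w * (z * cnj z + of_real (t\<^sup>2)) -
        (y * cnj z + cnj y * z)) / of_real t"
      by (simp add: pairing_mat2 H' herm_point_def p add_divide_distrib diff_divide_distrib distrib_left)
    then have "pairing H (herm_point p) = of_real ((x + w * ((cmod z)\<^sup>2 + t\<^sup>2) - 2 * (y \<bullet> z)) / t)"
      unfolding inner complex_norm_square[symmetric] by simp
    then show ?thesis by (auto simp: plane_of_def H3_def p simp del: of_real_add of_real_mult of_real_diff)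
  qed
  show ?thesis
  proof (cases "w = 0")
    case True
    then have y: "y \<noteq> 0" using neg' by auto
    define c where "c = (x / (2 * (y \<bullet> y))) *\<^sub>R y"
    have "y \<bullet> c = x / 2" using y by (simp add: c_def)
    then have "plane_of H = {(z, t). t > 0 \<and> y \<bullet> (z - c) = 0}"
      using True by (auto simp: pt inner_diff_right)
    then show ?thesis using y unfolding hyperbolic_plane_def by blast
  next
    case False
    define r where "r = sqrt (((cmod y)\<^sup>2 - x * w) / w\<^sup>2)"
    define c where "c = (1 / w) *\<^sub>R y"
    have "((cmod y)\<^sup>2 - x * w) / w\<^sup>2 > 0" using neg' False by simp
    then have r: "r > 0" "r\<^sup>2 = ((cmod y)\<^sup>2 - x * w) / w\<^sup>2" by (simp_all add: r_def)
    have "(cmod (z - c))\<^sup>2 = (cmod z)\<^sup>2 - 2 * (y \<bullet> z) / w + (cmod y)\<^sup>2 / w\<^sup>2" for z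
      unfolding power2_norm_eq_inner
      by (simp add: c_def inner_diff_left inner_diff_right inner_commute[of z y] diff_divide_distrib
          power2_eq_square)
    then have zc: "w * (cmod (z - c))\<^sup>2 = w * (cmod z)\<^sup>2 - 2 * (y \<bullet> z) + (cmod y)\<^sup>2 / w" for z
      using False by (simp add: field_simps power2_eq_square)
    have wr: "w * r\<^sup>2 = (cmod y)\<^sup>2 / w - x"
      unfolding r(2) using False by (simp add: field_simps power2_eq_square)
    have "x + w * ((cmod z)\<^sup>2 + t\<^sup>2) - 2 * (y \<bullet> z) = w * ((cmod (z - c))\<^sup>2 + t\<^sup>2 - r\<^sup>2)" for z t
      using zc[of z] wr by (simp add: distrib_left right_diff_distrib)
    then have "plane_of H = {(z, t). t > 0 \<and> (cmod (z - c))\<^sup>2 + t\<^sup>2 = r\<^sup>2}"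
      using False by (auto simp: pt)
    then show ?thesis using r(1) unfolding hyperbolic_plane_def by blast
  qed
qed

lemma matrix_group_stabilizer: "matrix_group {A. det A = 1 \<and> act_herm A H = H}"
  by (auto simp: matrix_group_def det_mul det_neg_2 det_I act_herm_mult) (metis act_herm_adj2(1))

text \<open>It suffices to check the two generators, because stabilizing a Hermitian matrix is a
  property of a matrix group.\<close>

lemma has_invariant_plane_generate:
  assumes A: "det A = 1" "act_herm A H = H" and B: "det B = 1" "act_herm B H = H"
    and H: "ctrans H = H" "Re (det H) < 0"
  shows "has_invariant_plane (generate PSL2C {psl A, psl B})"
proof -
  have "act_H3 x ` plane_of H = plane_of H" if x: "x \<in> generate PSL2C {psl A, psl B}" for x
  proof -
    have "x \<in> carrier PSL2C"
      using group.generate_in_carrier[OF group_PSL2C _ x] A B by (auto simp: psl_carrier)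
    then obtain Z where Z: "det Z = 1" "x = psl Z" by (rule PSL2C_cases)
    have "x \<subseteq> {A. det A = 1 \<and> act_herm A H = H}"
      using A B x by (intro generate_lifts_subset[OF A(1) B(1) matrix_group_stabilizer]) auto
    then have ZH: "act_herm Z H = H" using Z psl_self by auto
    have into: "act_H3 (psl Y) p \<in> plane_of H"
      if Y: "det Y = 1" "act_herm Y H = H" and p: "p \<in> plane_of H" for Y p
      using p pairing_act_herm[OF Y(1), of H "herm_point p"]
      by (simp add: plane_of_def act_point_psl Y)
    have "p \<in> act_H3 x ` plane_of H" if p: "p \<in> plane_of H" for p
    proof
      show "act_H3 (psl (adj2 Z)) p \<in> plane_of H"
        using Z ZH p act_herm_adj2(1)[OF Z(1), of H] by (intro into) simp_all
      have "p \<in> H3" using p by (simp add: plane_of_def)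
      moreover have "act_H3 (psl (mat 1)) p = p"
        using act_point_psl[of "mat 1" p] \<open>p \<in> H3\<close> by (auto intro: herm_point_inject simp: det_I)
      ultimately show "p = act_H3 x (act_H3 (psl (adj2 Z)) p)"
        using Z by (simp add: act_H3_psl_mult adj2_inverse)
    qed
    then show ?thesis using into Z ZH by blast
  qed
  then show ?thesis
    unfolding has_invariant_plane_def using hyperbolic_plane_plane_of[OF H] by blast
qed

lemma matrix_group_upper_triangular:
  assumes q: "det q = 1"
  shows "matrix_group {A. det A = 1 \<and> conj_by q A $ 2 $ 1 = 0}"
proof -
  have adj: "adj2 A $ 2 $ 1 = - A $ 2 $ 1" for A by (cases A) simp
  have mult: "(A ** B) $ 2 $ 1 = A $ 2 $ 1 * B $ 1 $ 1 + A $ 2 $ 2 * B $ 2 $ 1" for A B :: "complex^2^2"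
    by (cases A; cases B) simp
  have one: "(mat 1 :: complex^2^2) $ 2 $ 1 = 0" by (simp add: mat_1_mat2)
  show ?thesis
    by (auto simp: matrix_group_def conj_by_hom[OF q] det_mul det_neg_2 det_I adj mult one)
qed

text \<open>A common eigenvector, here the first column of \<open>q\<close>, is a common fixed point on the sphere.\<close>

lemma elementary_generate:
  assumes q: "det q = 1"
    and A: "det A = 1" "conj_by q A $ 2 $ 1 = 0" and B: "det B = 1" "conj_by q B $ 2 $ 1 = 0"
  shows "elementary (generate PSL2C {psl A, psl B})"
proof -
  obtain q1 q2 q3 q4 where q': "q = mat2 q1 q2 q3 q4" by (cases q)
  define w where "w = (if q3 = 0 then None else Some (q1 / q3))"
  have "act_sphere x w = w" if x: "x \<in> generate PSL2C {psl A, psl B}" for x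
  proof -
    have car: "x \<in> carrier PSL2C"
      using group.generate_in_carrier[OF group_PSL2C _ x] A B by (auto simp: psl_carrier)
    have "x \<subseteq> {A. det A = 1 \<and> conj_by q A $ 2 $ 1 = 0}"
      using A B x by (intro generate_lifts_subset[OF A(1) B(1) matrix_group_upper_triangular[OF q]]) auto
    then have L: "det (lift x) = 1" "conj_by q (lift x) $ 2 $ 1 = 0" using lift_in[OF car] by auto
    obtain a b c d where abcd: "lift x = mat2 a b c d" by (cases "lift x")
    obtain \<alpha> \<beta> \<gamma> \<delta> where T: "conj_by q (lift x) = mat2 \<alpha> \<beta> \<gamma> \<delta>" by (cases "conj_by q (lift x)")
    have "\<gamma> = 0" using L T by simp
    moreover have "det (conj_by q (lift x)) = 1" using L by (simp add: conj_by_hom[OF q])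
    ultimately have \<alpha>: "\<alpha> \<noteq> 0" using T by auto
    have "q ** conj_by q (lift x) = lift x ** q"
      by (simp add: conj_by_def adj2_cancel[OF q] flip: matrix_mul_assoc)
    then have e: "a * q1 + b * q3 = \<alpha> * q1" "c * q1 + d * q3 = \<alpha> * q3"
      using \<open>\<gamma> = 0\<close> unfolding T unfolding abcd q' by (auto simp: algebra_simps)
    show ?thesis
    proof (cases "q3 = 0")
      case True
      then have "q1 \<noteq> 0" using q q' by auto
      then have "c = 0" using e True by simp
      then show ?thesis using True by (simp add: act_sphere_def w_def abcd)
    next
      case False
      have "c * (q1 / q3) + d = \<alpha>" "a * (q1 / q3) + b = \<alpha> * (q1 / q3)"
        using e False by (simp_all add: field_simps)
      then show ?thesis using False \<alpha> by (simp add: act_sphere_def w_def abcd)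
    qed
  qed
  then have "(\<lambda>x. act_sphere x w) ` generate PSL2C {psl A, psl B} \<subseteq> {w}" by auto
  then have "finite ((\<lambda>x. act_sphere x w) ` generate PSL2C {psl A, psl B})"
    using finite_subset by blast
  then show ?thesis unfolding elementary_def by blast
qed

definition rotation_matrix :: "real \<Rightarrow> complex^2^2"
  where "rotation_matrix \<theta> = mat2 (cis (\<theta> / 2)) 0 0 (cis (- \<theta> / 2))"

lemma det_rotation_matrix [simp]: "det (rotation_matrix \<theta>) = 1"
  by (simp add: rotation_matrix_def cis_mult)

lemma act_rotation_matrix:
  "act_herm (rotation_matrix \<theta>) (herm_point (z, t)) = herm_point (cis \<theta> * z, t)"
proof -
  have "cis (\<theta> / 2) * (z * cis (\<theta> / 2)) = cis \<theta> * z"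
    "cis (- \<theta> / 2) * (z * cis (- \<theta> / 2)) = cis (- \<theta>) * z" for z \<theta>
    by (simp_all add: cis_mult mult.left_commute[of _ z] mult.commute[of z])
  then show ?thesis
    by (simp add: rotation_matrix_def act_herm_def herm_point_def cis_cnj norm_mult cis_mult mult_ac)
qed

text \<open>A rotation is recognized by its lifts: it is conjugate to a diagonal matrix with half the
  angle in the exponents. So the trace determines the angle up to sign and up to multiples of
  \<open>2\<pi>\<close>.\<close>

lemma is_rotation_psl_iff:
  assumes A: "det A = 1"
  shows "is_rotation \<theta> (psl A) \<longleftrightarrow>
    (\<exists>q. det q = 1 \<and> (conj_by q A = rotation_matrix \<theta> \<or> conj_by q A = - rotation_matrix \<theta>))"
    (is "?L \<longleftrightarrow> ?R")
proof
  assume ?L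
  then obtain x where x: "x \<in> carrier PSL2C"
    "\<And>z t. (z, t) \<in> H3 \<Longrightarrow> act_H3 (psl A) (act_H3 x (z, t)) = act_H3 x (cis \<theta> * z, t)"
    unfolding is_rotation_def by blast
  obtain q where q: "det q = 1" "x = psl q" using x(1) by (rule PSL2C_cases)
  let ?D = "rotation_matrix \<theta>"
  have "act_herm (adj2 ?D ** conj_by q A) (herm_point p) = herm_point p" if p: "p \<in> H3" for p
  proof -
    obtain z t where zt: "p = (z, t)" by (cases p)
    have p': "(cis \<theta> * z, t) \<in> H3" using p by (simp add: zt H3_def)
    have "act_herm (A ** q) (herm_point p) = act_herm q (herm_point (cis \<theta> * z, t))"
      using x(2) p p' A q by (simp add: act_herm_mult act_point_psl flip: zt) (simp add: zt)
    then have "act_herm (adj2 q) (act_herm (A ** q) (herm_point p)) = act_herm ?D (herm_point p)"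
      using q by (simp add: act_herm_adj2 act_rotation_matrix zt)
    then show ?thesis
      by (simp add: act_herm_mult conj_by_def act_herm_adj2)
  qed
  then have "adj2 ?D ** conj_by q A = mat 1 \<or> adj2 ?D ** conj_by q A = - mat 1"
    using A q by (intro act_herm_faithful) (simp_all add: det_mul conj_by_hom)
  then have "conj_by q A = ?D \<or> conj_by q A = - ?D"
    using adj2_cancel(1)[of ?D "conj_by q A"] by (auto simp: neg_mult_2)
  then show ?R using q by blast
next
  assume ?R
  then obtain q where q: "det q = 1" "conj_by q A = rotation_matrix \<theta> \<or> conj_by q A = - rotation_matrix \<theta>"
    by blast
  have *: "act_herm A (act_herm q H) = act_herm q (act_herm (rotation_matrix \<theta>) H)" for H
  proof -
    have "A ** q = q ** conj_by q A"
      using q by (simp add: conj_by_def adj2_cancel flip: matrix_mul_assoc)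
    then show ?thesis using q(2) by (metis act_herm_mult act_herm_neg)
  qed
  have "act_H3 (psl A) (act_H3 (psl q) (z, t)) = act_H3 (psl q) (cis \<theta> * z, t)" if "(z, t) \<in> H3" for z t
  proof (rule herm_point_inject)
    have p': "(cis \<theta> * z, t) \<in> H3" using that by (simp add: H3_def)
    show "herm_point (act_H3 (psl A) (act_H3 (psl q) (z, t))) = herm_point (act_H3 (psl q) (cis \<theta> * z, t))"
      using act_point_psl(1)[OF A act_point_psl(2)[OF q(1) that]] act_point_psl(1)[OF q(1) that]
        act_point_psl(1)[OF q(1) p'] * act_rotation_matrix by metis
    show "act_H3 (psl A) (act_H3 (psl q) (z, t)) \<in> H3" "act_H3 (psl q) (cis \<theta> * z, t) \<in> H3"
      using that A q p' by (simp_all add: act_point_psl)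
  qed
  then show ?L unfolding is_rotation_def using psl_carrier[OF q(1)] by blast
qed

section \<open>Discreteness in terms of matrices\<close>

text \<open>A neighbourhood of the identity suffices, since the sets considered are matrix groups and
  translations are homeomorphisms.\<close>

definition discrete_lifts :: "(complex^2^2) set \<Rightarrow> bool"
  where "discrete_lifts L \<longleftrightarrow> (\<exists>U. open U \<and> mat 1 \<in> U \<and> L \<inter> U \<subseteq> {mat 1, - mat 1})"

lemma continuous_on_matrix_mult [continuous_intros]:
  fixes F G :: "'a::topological_space \<Rightarrow> complex^2^2"
  assumes "continuous_on S F" "continuous_on S G"
  shows "continuous_on S (\<lambda>x. F x ** G x)"
  unfolding matrix_matrix_mult_def using assms
  by (intro continuous_on_vec_lambda continuous_intros) (auto intro!: continuous_intros)

lemma discrete_PSL2C_iff_lifts: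
  assumes "subgroup \<Gamma> PSL2C"
  shows "discrete_PSL2C \<Gamma> \<longleftrightarrow> discrete_lifts (\<Union>\<Gamma>)"
proof
  have sub: "\<Gamma> \<subseteq> carrier PSL2C" using assms by (rule subgroup.subset)
  have mem: "A \<in> \<Union>\<Gamma> \<longleftrightarrow> det A = 1 \<and> psl A \<in> \<Gamma>" for A
    using psl_member psl_self sub by blast
  {
    assume "discrete_PSL2C \<Gamma>"
    then have "openin (subtopology PSL2C_topology \<Gamma>) {psl (mat 1)}"
      using subgroup.one_closed[OF assms] by (simp add: discrete_PSL2C_def psl_one)
    then obtain T where T: "openin PSL2C_topology T" "{psl (mat 1)} = T \<inter> \<Gamma>"
      by (auto simp: openin_subtopology)
    then obtain V where V: "open V" "\<Union>T = carrier SL2C \<inter> V"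
      by (auto simp: openin_PSL2C_topology openin_open)
    have "mat 1 \<in> V" using T(2) V(2) psl_self by blast
    moreover have "\<Union>\<Gamma> \<inter> V \<subseteq> {mat 1, - mat 1}"
    proof
      fix A assume A: "A \<in> \<Union>\<Gamma> \<inter> V"
      then have "A \<in> \<Union>T" using V(2) mem by (auto simp: carrier_SL2C)
      then have "psl A \<in> T"
        using T(1) psl_member by (auto simp: openin_PSL2C_topology)
      then have "psl A \<in> T \<inter> \<Gamma>" using A mem by blast
      then have "psl A = psl (mat 1)" using T(2) by auto
      then show "A \<in> {mat 1, - mat 1}" by (auto simp: psl_eq_iff)
    qed
    ultimately show "discrete_lifts (\<Union>\<Gamma>)" using V(1) unfolding discrete_lifts_def by blast
  }
  assume "discrete_lifts (\<Union>\<Gamma>)"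
  then obtain U where U: "open U" "mat 1 \<in> U" "\<Union>\<Gamma> \<inter> U \<subseteq> {mat 1, - mat 1}"
    unfolding discrete_lifts_def by blast
  have "openin (subtopology PSL2C_topology \<Gamma>) {x}" if x: "x \<in> \<Gamma>" for x
  proof -
    obtain A where A: "det A = 1" "x = psl A" using x sub by (blast elim: PSL2C_cases)
    define W where "W = {B. adj2 A ** B \<in> U} \<union> {B. - (adj2 A ** B) \<in> U}"
    have "open W" unfolding W_def
      by (intro open_Un open_vimage[OF U(1), unfolded vimage_def] continuous_intros)
    define T where "T = {psl B | B. det B = 1 \<and> B \<in> W}"
    have "- B \<in> W" if "B \<in> W" for B using that by (auto simp: W_def neg_mult_2)
    then have "\<Union>T = carrier SL2C \<inter> W"
      by (auto simp: T_def carrier_SL2C det_neg_2) (auto simp: psl_def det_neg_2)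
    moreover have "T \<subseteq> carrier PSL2C" by (auto simp: T_def psl_carrier)
    ultimately have "openin PSL2C_topology T"
      using \<open>open W\<close> by (auto simp: openin_PSL2C_topology openin_open)
    moreover have "{x} = T \<inter> \<Gamma>"
    proof
      have "A \<in> W" using U(2) by (simp add: W_def adj2_inverse A)
      then show "{x} \<subseteq> T \<inter> \<Gamma>" using x A by (auto simp: T_def)
      show "T \<inter> \<Gamma> \<subseteq> {x}"
      proof
        fix y assume "y \<in> T \<inter> \<Gamma>"
        then obtain B where B: "y = psl B" "det B = 1" "B \<in> W" "psl B \<in> \<Gamma>" by (auto simp: T_def)
        have "matrix_group (\<Union>\<Gamma>)" using assms by (rule matrix_group_lifts)
        moreover have "A \<in> \<Union>\<Gamma>" "B \<in> \<Union>\<Gamma>" using A B x mem by auto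
        ultimately have "adj2 A ** B \<in> \<Union>\<Gamma>" "- (adj2 A ** B) \<in> \<Union>\<Gamma>"
          unfolding matrix_group_def by blast+
        then have "adj2 A ** B \<in> {mat 1, - mat 1} \<or> - (adj2 A ** B) \<in> {mat 1, - mat 1}"
          using B(3) U(3) unfolding W_def by blast
        then have "adj2 A ** B = mat 1 \<or> adj2 A ** B = - mat 1" by (auto simp: minus_equation_iff)
        then have "A ** (adj2 A ** B) = A \<or> A ** (adj2 A ** B) = - A" by (auto simp: neg_mult_2)
        then show "y \<in> {x}" using A B by (auto simp: adj2_cancel psl_def)
      qed
    qed
    ultimately show ?thesis by (auto simp: openin_subtopology)
  qed
  then have "discrete_topology \<Gamma> = subtopology PSL2C_topology \<Gamma>"
    using sub by (simp add: discrete_topology_unique topspace_PSL2C Int_absorb1)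
  then show "discrete_PSL2C \<Gamma>" by (simp add: discrete_PSL2C_def)
qed

lemma discrete_lifts_conj:
  assumes q: "det q = 1"
  shows "discrete_lifts (conj_by q ` L) \<longleftrightarrow> discrete_lifts L"
proof -
  have *: "discrete_lifts (conj_by q ` L)" if L: "discrete_lifts L" and q: "det q = 1" for L q
  proof -
    obtain U where U: "open U" "mat 1 \<in> U" "L \<inter> U \<subseteq> {mat 1, - mat 1}"
      using L unfolding discrete_lifts_def by blast
    have "open {B. conj_by (adj2 q) B \<in> U}" unfolding conj_by_def
      by (intro open_vimage[OF U(1), unfolded vimage_def] continuous_intros)
    moreover have "mat 1 \<in> {B. conj_by (adj2 q) B \<in> U}" using U(2) q by (simp add: conj_by_hom)
    moreover have "conj_by q ` L \<inter> {B. conj_by (adj2 q) B \<in> U} \<subseteq> {mat 1, - mat 1}"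
    proof
      fix B assume "B \<in> conj_by q ` L \<inter> {B. conj_by (adj2 q) B \<in> U}"
      then obtain A where "A \<in> L" "B = conj_by q A" "A \<in> U" by (auto simp: conj_by_inverse q)
      then have "A = mat 1 \<or> A = - mat 1" using U(3) by blast
      then show "B \<in> {mat 1, - mat 1}" using \<open>B = conj_by q A\<close> by (auto simp: conj_by_hom q)
    qed
    ultimately show ?thesis unfolding discrete_lifts_def by blast
  qed
  have "conj_by (adj2 q) ` conj_by q ` L = L" by (simp add: image_image conj_by_inverse q)
  then show ?thesis using *[of L q] *[of "conj_by q ` L" "adj2 q"] q by auto
qed

lemma discrete_lifts_sequence:
  assumes "discrete_lifts L" "\<And>n. A n \<in> L" "A \<longlonglongrightarrow> mat 1"
  shows "\<forall>\<^sub>F n in sequentially. A n = mat 1 \<or> A n = - mat 1"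
proof -
  obtain U where U: "open U" "mat 1 \<in> U" "L \<inter> U \<subseteq> {mat 1, - mat 1}"
    using assms(1) unfolding discrete_lifts_def by blast
  have "\<forall>\<^sub>F n in sequentially. A n \<in> U" using assms(3) U(1,2) by (rule topological_tendstoD)
  then show ?thesis by (rule eventually_mono) (use U(3) assms(2) in blast)
qed

section \<open>The reflection group\<close>

text \<open>The values of \<open>-2\<close> times the inner product of the unit normals for which two planes may bound
  a common chamber: a dihedral angle \<open>\<pi>/m\<close> with \<open>m \<ge> 3\<close>, tangency, or disjointness.\<close>

definition mirror_bound :: "real \<Rightarrow> bool"
  where "mirror_bound t \<longleftrightarrow> t \<ge> 2 \<or> (\<exists>m::nat. m \<ge> 3 \<and> t = 2 * cos (pi / real m))"

definition transl :: "complex^2^2"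
  where "transl = mat2 1 1 0 1"

text \<open>The normal form of \<open>f\<close>: the reflection in the plane \<open>Im z = \<tau>/(2r)\<close>, followed by the
  inversion in the sphere of radius \<open>1/r\<close> about \<open>0\<close>. It is elliptic, parabolic or hyperbolic
  depending on how these two planes meet.\<close>

definition inversion :: "real \<Rightarrow> real \<Rightarrow> complex^2^2"
  where "inversion r \<tau> = mat2 0 (\<i> / r) (\<i> * r) \<tau>"

lemma det_transl: "det transl = 1" by (simp add: transl_def)

lemma det_inversion: "r \<noteq> 0 \<Longrightarrow> det (inversion r \<tau>) = 1"
  by (simp add: inversion_def)

definition gram :: "real \<Rightarrow> real \<Rightarrow> 4 \<Rightarrow> 4 \<Rightarrow> real"
  where "gram r \<tau> i j = (if i = j then 1 else if {i, j} = {1, 2} then - 1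
    else if {i, j} = {2, 3} then - r / 2 else if {i, j} = {3, 4} then - \<bar>\<tau>\<bar> / 2 else 0)"

lemma coxeter_form_gram:
  assumes r: "mirror_bound r" and \<tau>: "mirror_bound \<bar>\<tau>\<bar>"
  shows "coxeter_form (gram r \<tau>)"
proof
  fix i j :: 4
  show "gram r \<tau> i j = gram r \<tau> j i" by (simp add: gram_def insert_commute)
  show "gram r \<tau> i i = 1" by (simp add: gram_def)
  have edge: "- t / 2 \<le> - 1 \<or> (\<exists>m::nat. m \<ge> 2 \<and> - t / 2 = - cos (pi / real m))"
    if t: "mirror_bound t" for t
  proof (cases "t \<ge> 2")
    case False
    then obtain m :: nat where "m \<ge> 3" "t = 2 * cos (pi / real m)"
      using t unfolding mirror_bound_def by blast
    then show ?thesis by (intro disjI2 exI[of _ m]) simp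
  qed simp
  have "\<exists>m::nat. m \<ge> 2 \<and> 0 = - cos (pi / real m)" by (intro exI[of _ 2]) simp
  then show "gram r \<tau> i j \<le> - 1 \<or> (\<exists>m::nat. m \<ge> 2 \<and> gram r \<tau> i j = - cos (pi / real m))" if "i \<noteq> j"
    using edge[OF r] edge[OF \<tau>] that unfolding gram_def by auto
qed

text \<open>The combination with coefficients \<open>v\<close> of the Hermitian matrices of the four planes
  \<open>Re z = 0\<close>, \<open>Re z = 1/2\<close>, \<open>\<bar>z\<bar>\<^sup>2 + t\<^sup>2 = 1/r\<^sup>2\<close>, \<open>Im z = \<tau>/(2r)\<close>. All are oriented so that
  their pairing with a point is negative in the region \<open>0 < Re z < 1/2\<close>, \<open>\<bar>z\<bar>\<^sup>2 + t\<^sup>2 > 1/r\<^sup>2\<close> on the side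
  of the last plane that contains \<open>Im z = 0\<close>, whence the sign of \<open>\<tau>\<close>.\<close>

definition wall :: "real \<Rightarrow> real \<Rightarrow> real^4 \<Rightarrow> complex^2^2"
  where "wall r \<tau> v = mat2 (of_real (- v$2 + v$3 / r - \<bar>\<tau>\<bar> * v$4 / r))
    (of_real (v$1 - v$2) - \<i> * of_real (sgn \<tau> * v$4))
    (of_real (v$1 - v$2) + \<i> * of_real (sgn \<tau> * v$4)) (of_real (- r * v$3))"

text \<open>The matrices act on the span of the walls as products of two reflections. This carries
  statements about words over to the matrix group.\<close>

lemma act_transl:
  assumes "coxeter_form (gram r \<tau>)" "r \<noteq> 0" "\<tau> \<noteq> 0"
  shows "act_herm transl (wall r \<tau> v) = wall r \<tau> (coxeter_form.word (gram r \<tau>) [2, 1] v)"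
proof -
  interpret coxeter_form "gram r \<tau>" by fact
  show ?thesis using assms(2,3)
    by (cases rule: linorder_cases[of \<tau> 0])
      (simp_all add: act_herm_def transl_def wall_def reflection_nth form_def sum_4 gram_def
        doubleton_eq_iff field_simps)
qed

lemma act_inversion:
  assumes "coxeter_form (gram r \<tau>)" "r \<noteq> 0" "\<tau> \<noteq> 0"
  shows "act_herm (inversion r \<tau>) (wall r \<tau> v) = wall r \<tau> (coxeter_form.word (gram r \<tau>) [3, 4] v)"
proof -
  interpret coxeter_form "gram r \<tau>" by fact
  show ?thesis using assms(2,3)
    by (cases rule: linorder_cases[of \<tau> 0])
      (simp_all add: act_herm_def inversion_def wall_def reflection_nth form_def sum_4 gram_def
        doubleton_eq_iff field_simps)
qed

text \<open>The point over \<open>1/4\<close> at height \<open>1/r\<close> lies inside the chamber: all four coefficients have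
  the same sign.\<close>

lemma pairing_chamber_point:
  assumes "r > 0"
  shows "pairing (herm_point (1 / 4, 1 / r)) (wall r \<tau> v) =
    - of_real (r / 2 * v$1 + r / 2 * v$2 + r\<^sup>2 / 16 * v$3 + \<bar>\<tau>\<bar> * v$4)"
  using assms
  by (simp add: herm_point_def wall_def pairing_mat2 complex_eq_iff field_simps power2_eq_square)

lemma point_is_wall:
  assumes "r \<noteq> 0" "\<tau> \<noteq> 0"
  shows "\<exists>v. herm_point p = wall r \<tau> v"
proof -
  obtain z t where p: "p = (z, t)" by (cases p)
  define v3 v4 where "v3 = - 1 / (t * r)" and "v4 = - sgn \<tau> * Im z / t"
  define v2 where "v2 = v3 / r - \<bar>\<tau>\<bar> * v4 / r - ((cmod z)\<^sup>2 + t\<^sup>2) / t"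
  define v :: "real^4" where
    "v = (\<chi> i. if i = 1 then Re z / t + v2 else if i = 2 then v2 else if i = 3 then v3 else v4)"
  have v: "v $ 1 = Re z / t + v2" "v $ 2 = v2" "v $ 3 = v3" "v $ 4 = v4"
    by (simp_all add: v_def)
  have "sgn \<tau> * v4 = - Im z / t"
    using assms(2) by (simp add: v4_def sgn_if)
  moreover have "- v2 + v3 / r - \<bar>\<tau>\<bar> * v4 / r = ((cmod z)\<^sup>2 + t\<^sup>2) / t"
    by (simp add: v2_def)
  moreover have "- r * v3 = 1 / t" using assms(1) by (simp add: v3_def)
  moreover have "herm_point p = mat2 (of_real (((cmod z)\<^sup>2 + t\<^sup>2) / t)) (z / of_real t) (cnj z / of_real t)
      (of_real (1 / t))"
    by (simp add: p herm_point_def complex_norm_square flip: of_real_power)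
  moreover have "z / of_real t = of_real (Re z / t) - \<i> * of_real (- Im z / t)"
    "cnj z / of_real t = of_real (Re z / t) + \<i> * of_real (- Im z / t)"
    by (simp_all add: complex_eq_iff)
  ultimately show ?thesis unfolding wall_def by (intro exI[of _ v]) (simp only: v add_diff_cancel_right')
qed

lemma continuous_on_pairing_act_herm: "continuous_on S (\<lambda>A. pairing K (act_herm A H))"
proof -
  have p: "pairing K H = K$1$1 * H$2$2 + K$2$2 * H$1$1 - K$1$2 * H$2$1 - K$2$1 * H$1$2" for K H
    by (cases K; cases H) (simp add: pairing_mat2)
  have c: "ctrans A = (\<chi> i j. cnj (A $ j $ i))" for A
    by (simp add: ctrans_def vec_eq_iff forall_2)
  show ?thesis unfolding p act_herm_def c
    by (intro continuous_intros)
qed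

text \<open>The matrices that act on the walls as a word form a group containing both generators. If such
  a word is nontrivial, it turns some simple root nonpositive. Near the identity, however, the
  chosen point of the chamber stays strictly on the inner side of the images of all four walls.\<close>

theorem discrete_reflection_group:
  assumes r: "r > 0" "mirror_bound r" and \<tau>: "\<tau> \<noteq> 0" "mirror_bound \<bar>\<tau>\<bar>"
  shows "\<exists>L. matrix_group L \<and> transl \<in> L \<and> inversion r \<tau> \<in> L \<and> discrete_lifts L"
proof -
  have cox: "coxeter_form (gram r \<tau>)" using r(2) \<tau>(2) by (rule coxeter_form_gram)
  interpret coxeter_form "gram r \<tau>" by (rule cox)
  define F where "F = wall r \<tau>"
  define L where "L = {A. det A = 1 \<and> (\<exists>xs. \<forall>v. act_herm A (F v) = F (word xs v))}"
  have "matrix_group L" unfolding matrix_group_def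
  proof (intro conjI ballI)
    show "mat 1 \<in> L" by (auto simp: L_def det_I intro: exI[of _ "[]"])
  next
    fix A assume A: "A \<in> L"
    then obtain xs where xs: "det A = 1" "\<And>v. act_herm A (F v) = F (word xs v)"
      by (auto simp: L_def)
    then show "det A = 1" "- A \<in> L" by (auto simp: L_def det_neg_2)
    have "act_herm (adj2 A) (F v) = F (word (rev xs) v)" for v
      using xs(2)[of "word (rev xs) v"] word_rev[of "rev xs" v] act_herm_adj2(1)[OF xs(1)]
      by (metis rev_rev_ident)
    then show "adj2 A \<in> L" using xs(1) unfolding L_def by auto
    fix B assume "B \<in> L"
    then obtain ys where ys: "det B = 1" "\<And>v. act_herm B (F v) = F (word ys v)"
      by (auto simp: L_def)
    have "act_herm (A ** B) (F v) = F (word (xs @ ys) v)" for v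
      by (simp add: act_herm_mult xs ys)
    then show "A ** B \<in> L" using xs(1) ys(1) unfolding L_def by (auto simp: det_mul simp del: word_simps)
  qed
  moreover have "transl \<in> L" "inversion r \<tau> \<in> L"
    using act_transl[OF cox] act_inversion[OF cox] r(1) \<tau>(1) unfolding L_def F_def mem_Collect_eq
    by (metis det_transl less_irrefl, metis det_inversion less_irrefl)
  moreover have "discrete_lifts L"
  proof -
    define h where "h = (\<lambda>H. - Re (pairing (herm_point (1 / 4, 1 / r)) H))"
    have h: "h (F v) = r / 2 * v$1 + r / 2 * v$2 + r\<^sup>2 / 16 * v$3 + \<bar>\<tau>\<bar> * v$4" for v
      unfolding h_def F_def pairing_chamber_point[OF r(1)] by simp
    define U where "U = (\<Inter>s. {A. h (act_herm A (F (simple_root s))) > 0})"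
    have "open {A. h (act_herm A H) > 0}" for H unfolding h_def
      by (intro open_Collect_less continuous_on_const continuous_on_minus continuous_on_Re
          continuous_on_pairing_act_herm)
    then have "open U" unfolding U_def by (intro open_INT) auto
    moreover have "mat 1 \<in> U"
      using r(1) \<tau>(1) by (auto simp: U_def h simple_root_def axis_def forall_4)
    moreover have "L \<inter> U \<subseteq> {mat 1, - mat 1}"
    proof
      fix A assume A: "A \<in> L \<inter> U"
      then obtain xs where xs: "det A = 1" "\<And>v. act_herm A (F v) = F (word xs v)"
        by (auto simp: L_def)
      have "word xs = id"
      proof (rule ccontr)
        assume "word xs \<noteq> id"
        then obtain s where s: "\<And>i. word xs (simple_root s) $ i \<le> 0"
          using nontrivial_word_makes_root_negative by blast
        have "h (act_herm A (F (simple_root s))) \<le> 0"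
          unfolding xs h using s r(1)
          by (intro add_nonpos_nonpos mult_nonneg_nonpos) auto
        then show False using A by (auto simp: U_def not_less[symmetric])
      qed
      then have "act_herm A (herm_point p) = herm_point p" for p
        using point_is_wall[of r \<tau> p] r(1) \<tau>(1) xs(2) by (auto simp: F_def)
      then show "A \<in> {mat 1, - mat 1}" using act_herm_faithful[OF xs(1)] by blast
    qed
    ultimately show ?thesis unfolding discrete_lifts_def by blast
  qed
  ultimately show ?thesis by blast
qed

section \<open>Necessary conditions for discreteness\<close>

text \<open>The first column in the sequence \<open>Z\<^sub>0 = Z\<close>, \<open>Z\<^sub>n\<^sub>+\<^sub>1 = Z\<^sub>n g Z\<^sub>n\<^sup>-\<^sup>1\<close>, where \<open>g\<close> is the
  translation; it does not depend on the second column.\<close>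

primrec shimizu :: "complex \<Rightarrow> complex \<Rightarrow> nat \<Rightarrow> complex \<times> complex" where
  "shimizu a c 0 = (a, c)"
| "shimizu a c (Suc n) = (case shimizu a c n of (a', c') \<Rightarrow> (1 - a' * c', - c'\<^sup>2))"

lemma conj_transl:
  assumes "a * d - b * c = 1"
  shows "mat2 a b c d ** transl ** adj2 (mat2 a b c d) = mat2 (1 - a * c) (a\<^sup>2) (- c\<^sup>2) (1 + a * c)"
  using assms by (simp add: transl_def algebra_simps power2_eq_square)

lemma tendsto_mat2:
  assumes "a \<longlonglongrightarrow> a'" "b \<longlonglongrightarrow> b'" "c \<longlonglongrightarrow> c'" "d \<longlonglongrightarrow> d'"
  shows "(\<lambda>n. mat2 (a n) (b n) (c n) (d n)) \<longlonglongrightarrow> mat2 a' b' c' d'"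
proof (rule vec_tendstoI)
  fix i :: 2
  show "(\<lambda>n. mat2 (a n) (b n) (c n) (d n) $ i) \<longlonglongrightarrow> mat2 a' b' c' d' $ i"
  proof (rule vec_tendstoI)
    fix j :: 2
    show "(\<lambda>n. mat2 (a n) (b n) (c n) (d n) $ i $ j) \<longlonglongrightarrow> mat2 a' b' c' d' $ i $ j"
      using assms exhaust_2[of i] exhaust_2[of j] by auto
  qed
qed

text \<open>The inequality of Shimizu and Leutbecher. If the lower left entry is less than 1 in modulus,
  the sequence \<open>Z\<^sub>n\<close> converges to the translation without reaching it, because this entry is squared
  up to sign in each step. Only \<open>Z g Z\<^sup>-\<^sup>1\<close> has to be in the group, not \<open>Z\<close>, since the sequence lies in
  the group from its second member on.\<close>

lemma shimizu_leutbecher: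
  assumes L: "discrete_lifts L" "matrix_group L" "transl \<in> L"
    and Z: "det (mat2 a b c d) = 1" "mat2 a b c d ** transl ** adj2 (mat2 a b c d) \<in> L"
    and c: "c \<noteq> 0"
  shows "cmod c \<ge> 1"
proof (rule ccontr)
  assume "\<not> cmod c \<ge> 1"
  define \<rho> where "\<rho> = cmod c"
  have \<rho>: "0 < \<rho>" "\<rho> < 1" using c \<open>\<not> cmod c \<ge> 1\<close> by (auto simp: \<rho>_def)
  define A where "A n = fst (shimizu a c n)" for n
  define C where "C n = snd (shimizu a c n)" for n
  have A: "A 0 = a" "\<And>n. A (Suc n) = 1 - A n * C n"
    and C: "C 0 = c" "\<And>n. C (Suc n) = - (C n)\<^sup>2"
    by (simp_all add: A_def C_def split_beta)
  have C0: "C n \<noteq> 0" for n by (induction n) (simp_all add: C c)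
  have \<rho>_power: "\<rho> ^ Suc n \<le> \<rho>" for n
    using power_decreasing[of 1 "Suc n" \<rho>] \<rho> by simp
  have C1: "cmod (C n) \<le> \<rho> ^ Suc n" for n
  proof (induction n)
    case (Suc n)
    have "cmod (C (Suc n)) = cmod (C n) * cmod (C n)"
      by (simp add: C norm_mult power2_eq_square)
    also have "\<dots> \<le> \<rho> ^ Suc n * \<rho>"
    proof (rule mult_mono)
      show "cmod (C n) \<le> \<rho>" using Suc \<rho>_power[of n] by (rule order_trans)
    qed (use Suc \<rho> in auto)
    finally show ?case by (simp add: mult_ac)
  qed (simp add: C \<rho>_def)
\<comment> \<open>The invariant bound for \<open>\<bar>a\<bar>\<close> under \<open>a \<mapsto> 1 - a c\<close> with \<open>\<bar>c\<bar> \<le> \<rho>\<close>.\<close>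
  define K where "K = max (cmod a) (1 / (1 - \<rho>))"
  have K: "1 + K * \<rho> \<le> K" "0 \<le> K"
  proof -
    have "1 / (1 - \<rho>) \<le> K" by (simp add: K_def)
    then show "1 + K * \<rho> \<le> K" using \<rho> by (simp add: field_simps)
    show "0 \<le> K" by (simp add: K_def le_max_iff_disj)
  qed
  have C\<rho>: "cmod (C n) \<le> \<rho>" for n
    using C1[of n] \<rho>_power[of n] by (rule order_trans)
  have AK: "cmod (A n) \<le> K" for n
  proof (induction n)
    case (Suc n)
    have "cmod (A (Suc n)) \<le> 1 + cmod (A n) * cmod (C n)"
      using norm_triangle_ineq4[of 1 "A n * C n"] by (simp add: A norm_mult)
    also have "\<dots> \<le> 1 + K * \<rho>"
      using Suc C\<rho>[of n] K \<rho> by (intro add_left_mono mult_mono) auto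
    finally show ?case using K by simp
  qed (simp add: A K_def)
  have \<rho>0: "(\<lambda>n. \<rho> ^ Suc n) \<longlonglongrightarrow> 0"
    using \<rho> by (intro LIMSEQ_Suc LIMSEQ_power_zero) simp
  have Clim: "C \<longlonglongrightarrow> 0"
    by (rule Lim_null_comparison[OF _ \<rho>0]) (use C1 in simp)
  have AClim: "(\<lambda>n. A n * C n) \<longlonglongrightarrow> 0"
  proof (rule Lim_null_comparison)
    show "(\<lambda>n. K * \<rho> ^ Suc n) \<longlonglongrightarrow> 0" using tendsto_mult_left[OF \<rho>0, of K] by simp
    show "\<forall>\<^sub>F n in sequentially. cmod (A n * C n) \<le> K * \<rho> ^ Suc n"
      using AK C1 K by (auto simp: norm_mult simp del: power_Suc intro!: always_eventually mult_mono)
  qed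
  have "(\<lambda>n. A (Suc n)) \<longlonglongrightarrow> 1 - 0" unfolding A by (intro tendsto_intros AClim)
  then have Alim: "A \<longlonglongrightarrow> 1" by - (rule LIMSEQ_imp_Suc, simp)
  define T where "T n = mat2 (1 - A n * C n) ((A n)\<^sup>2) (- (C n)\<^sup>2) (1 + A n * C n)" for n
  have closed: "\<And>Y. Y \<in> L \<Longrightarrow> adj2 Y \<in> L" "\<And>Y Z. Y \<in> L \<Longrightarrow> Z \<in> L \<Longrightarrow> Y ** Z \<in> L"
    using L(2) by (auto simp: matrix_group_def)
  have T: "T n \<in> L" for n
  proof (induction n)
    case 0
    then show ?case using Z conj_transl[of a d b c] by (simp add: T_def A C)
  next
    case (Suc n)
    have "T (Suc n) = T n ** transl ** adj2 (T n)"
      unfolding T_def A(2)[of n] C(2)[of n]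
      by (subst conj_transl) (simp_all add: algebra_simps power2_eq_square)
    then show ?case using Suc L(3) closed by simp
  qed
  have TT: "T n ** adj2 transl =
      mat2 (1 - A n * C n) (A n * C n - 1 + (A n)\<^sup>2) (- (C n)\<^sup>2) ((C n)\<^sup>2 + 1 + A n * C n)" for n
    by (simp add: T_def transl_def)
  have "(\<lambda>n. T n ** adj2 transl) \<longlonglongrightarrow> mat 1"
    using tendsto_mat2[OF tendsto_diff[OF tendsto_const[of 1] AClim]
        tendsto_add[OF tendsto_diff[OF AClim tendsto_const[of 1]] tendsto_power[OF Alim, of 2]]
        tendsto_minus[OF tendsto_power[OF Clim, of 2]]
        tendsto_add[OF tendsto_add[OF tendsto_power[OF Clim, of 2] tendsto_const[of 1]] AClim]]
    unfolding TT mat_1_mat2 by simp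
  from discrete_lifts_sequence[OF L(1) _ this]
  have "\<forall>\<^sub>F n in sequentially. T n ** adj2 transl = mat 1 \<or> T n ** adj2 transl = - mat 1"
    using T L(3) closed by blast
  then obtain n where "T n ** adj2 transl = mat 1 \<or> T n ** adj2 transl = - mat 1"
    unfolding eventually_sequentially by blast
  then show False using C0[of n] by (auto simp: TT mat_1_mat2)
qed

text \<open>The half-turn \<open>z \<mapsto> - 1 / (r\<^sup>2 z)\<close>, the product of the reflections in \<open>Re z = 0\<close> and in the
  sphere of radius \<open>1/r\<close>.\<close>

definition half_turn :: "real \<Rightarrow> complex^2^2"
  where "half_turn r = mat2 0 (1 / r) (- r) 0"

text \<open>Together with the half-turn this generates a conjugate of the Hecke group with parameter
  \<open>r\<close>.\<close>

definition hecke :: "real \<Rightarrow> complex^2^2"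
  where "hecke r = mat2 0 (1 / r) (- r) r"

lemma det_hecke: "r \<noteq> 0 \<Longrightarrow> det (hecke r) = 1" by (simp add: hecke_def)
lemma det_half_turn: "r \<noteq> 0 \<Longrightarrow> det (half_turn r) = 1" by (simp add: half_turn_def)

lemma hecke_eq: "hecke r = half_turn r ** adj2 transl"
  by (simp add: hecke_def half_turn_def transl_def)

lemma hecke_power:
  assumes "r \<noteq> 0"
  shows "mpow (hecke r) (Suc n) =
    mat2 (of_real (- cheb (r / 2) n)) (of_real (cheb (r / 2) (Suc n) / r))
      (of_real (- r * cheb (r / 2) (Suc n))) (of_real (cheb (r / 2) (Suc (Suc n))))"
proof (induction n)
  case 0
  then show ?case by (simp add: mat_1_mat2 hecke_def)
next
  case (Suc n)
  have "mpow (hecke r) (Suc (Suc n)) = mpow (hecke r) (Suc n) ** hecke r" by simp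
  then show ?case unfolding Suc using assms by (simp add: hecke_def field_simps)
qed

text \<open>The half-turn \<open>w\<close> conjugates \<open>g\<close> to the inverse of \<open>f g f\<^sup>-\<^sup>1\<close>, an element of the group.
  Every power of \<open>h = w g\<^sup>-\<^sup>1\<close> is therefore, up to a factor \<open>w\<close> on the right, in the group, and this
  factor turns the conjugate of \<open>g\<close> into a conjugate of \<open>w g w\<^sup>-\<^sup>1\<close>.\<close>

lemma hecke_power_conj_transl:
  assumes L: "matrix_group L" "transl \<in> L" "inversion r \<tau> \<in> L" and r: "r \<noteq> 0"
  shows "mpow (hecke r) m ** transl ** adj2 (mpow (hecke r) m) \<in> L"
proof -
  let ?w = "half_turn r" and ?h = "mpow (hecke r)"
  note wd = adj2_cancel[OF det_half_turn[OF r]] adj2_inverse[OF det_half_turn[OF r]]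
  have closed: "\<And>Y. Y \<in> L \<Longrightarrow> adj2 Y \<in> L" "\<And>Y. Y \<in> L \<Longrightarrow> - Y \<in> L"
    "\<And>Y Z. Y \<in> L \<Longrightarrow> Z \<in> L \<Longrightarrow> Y ** Z \<in> L" "mat 1 \<in> L"
    using L(1) by (auto simp: matrix_group_def)
  define E where "E = ?w ** transl ** adj2 ?w"
  have "E = adj2 (inversion r \<tau> ** transl ** adj2 (inversion r \<tau>))"
    using r by (simp add: E_def half_turn_def transl_def inversion_def algebra_simps)
  then have E: "E \<in> L" using L closed by simp
  have E': "adj2 E = ?w ** adj2 transl ** adj2 ?w"
    by (simp add: E_def adj2_mult matrix_mul_assoc)
  have w2: "?w ** ?w = - mat 1" using r by (simp add: half_turn_def mat_1_mat2)
  have "?h m \<in> L \<or> ?h m ** adj2 ?w \<in> L" for m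
  proof (induction m)
    case (Suc m)
    then show ?case
    proof
      assume "?h m \<in> L"
      then have "?h m ** adj2 E \<in> L" using E closed by blast
      then show ?thesis by (simp add: E' hecke_eq matrix_mul_assoc)
    next
      assume "?h m ** adj2 ?w \<in> L"
      then have "- (?h m ** adj2 ?w ** adj2 transl) \<in> L" using L(2) closed by blast
      also have "- (?h m ** adj2 ?w ** adj2 transl) = ?h m ** (adj2 ?w ** (?w ** ?w)) ** adj2 transl"
        by (simp add: w2 neg_mult_2)
      also have "\<dots> = ?h (Suc m)" by (simp add: wd hecke_eq flip: matrix_mul_assoc)
      finally show ?thesis ..
    qed
  qed (simp add: closed)
  from this[of m] show ?thesis
  proof
    assume "?h m \<in> L"
    then show ?thesis using L(2) closed by simp
  next
    assume "?h m ** adj2 ?w \<in> L"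
    then have "?h m ** adj2 ?w ** E ** adj2 (?h m ** adj2 ?w) \<in> L" using E closed by simp
    also have "?h m ** adj2 ?w ** E ** adj2 (?h m ** adj2 ?w) = ?h m ** transl ** adj2 (?h m)"
      by (simp add: E_def adj2_mult wd flip: matrix_mul_assoc)
    finally show ?thesis .
  qed
qed

text \<open>Let \<open>m \<phi>\<close> be the last multiple of \<open>\<phi>\<close> up to \<open>\<pi>\<close>. It differs from \<open>\<pi>\<close>, because \<open>\<phi>\<close> is
  not of the form \<open>\<pi>/m\<close>. Of the two gaps from \<open>\<pi>\<close> to \<open>m \<phi>\<close> and to \<open>(m + 1) \<phi>\<close>, which sum to \<open>\<phi>\<close>,
  the smaller is at most \<open>\<phi>/2\<close>.\<close>

lemma small_sine_multiple:
  assumes \<phi>: "0 < \<phi>" "\<phi> < pi / 2" and no: "\<And>m::nat. m \<ge> 3 \<Longrightarrow> \<phi> \<noteq> pi / real m"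
  shows "\<exists>k. sin (real k * \<phi>) \<noteq> 0 \<and> \<bar>sin (real k * \<phi>)\<bar> \<le> sin (\<phi> / 2)"
proof -
  define m where "m = nat \<lfloor>pi / \<phi>\<rfloor>"
  define \<delta> where "\<delta> = pi - real m * \<phi>"
  have m: "real m \<le> pi / \<phi>" "pi / \<phi> < real m + 1"
    using \<phi> unfolding m_def by (simp_all add: of_nat_nat)
  have \<delta>: "0 \<le> \<delta>" "\<delta> < \<phi>" using m \<phi> by (simp_all add: \<delta>_def field_simps)
  have "\<delta> \<noteq> 0"
  proof
    assume "\<delta> = 0"
    then have eq: "pi = real m * \<phi>" by (simp add: \<delta>_def)
    then have "real m * \<phi> > 2 * \<phi>" using \<phi> by simp
    then have "real m > 2" using \<phi>(1) by simp
    then have "m \<ge> 3" by linarith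
    then have "real m \<noteq> 0" by simp
    then have "\<phi> = pi / real m" unfolding eq by simp
    then show False using no[of m] \<open>m \<ge> 3\<close> by simp
  qed
  have small: "0 < sin x \<and> sin x \<le> sin (\<phi> / 2)" if "0 < x" "x \<le> \<phi> / 2" for x
    using that \<phi> by (auto intro: sin_gt_zero sin_monotone_2pi_le)
  show ?thesis
  proof (cases "\<delta> \<le> \<phi> / 2")
    case True
    have "sin (real m * \<phi>) = sin (pi - \<delta>)" by (simp add: \<delta>_def)
    then have "sin (real m * \<phi>) = sin \<delta>" by simp
    then show ?thesis using small[of \<delta>] True \<delta> \<open>\<delta> \<noteq> 0\<close> by (intro exI[of _ m]) simp
  next
    case False
    have "real (Suc m) * \<phi> = pi + (\<phi> - \<delta>)" by (simp add: \<delta>_def algebra_simps)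
    then have "sin (real (Suc m) * \<phi>) = - sin (\<phi> - \<delta>)" by (simp only: sin_periodic_pi2)
    then show ?thesis using small[of "\<phi> - \<delta>"] False \<delta> by (intro exI[of _ "Suc m"]) simp
  qed
qed

text \<open>For the multiple \<open>k \<phi>\<close> of \<open>small_sine_multiple\<close> the lower left entry of \<open>h\<^sup>k\<close> has
  modulus at most \<open>2 cos \<phi> sin (\<phi>/2) / sin \<phi> = cos \<phi> / cos (\<phi>/2) < 1\<close>, contrary to the inequality of
  Shimizu and Leutbecher.\<close>

theorem discrete_imp_mirror_bound:
  assumes L: "discrete_lifts L" "matrix_group L" "transl \<in> L" "inversion r \<tau> \<in> L" and r: "r > 0"
  shows "mirror_bound r"
proof (rule ccontr)
  assume no: "\<not> mirror_bound r"
  define \<phi> where "\<phi> = arccos (r / 2)"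
  have r2: "r < 2" using no by (simp add: mirror_bound_def)
  have cos: "r = 2 * cos \<phi>" using r r2 by (simp add: \<phi>_def)
  have \<phi>: "0 < \<phi>" "\<phi> < pi / 2"
  proof -
    show "0 < \<phi>" unfolding \<phi>_def using arccos_less_arccos[of "r / 2" 1] r r2 by simp
    show "\<phi> < pi / 2" unfolding \<phi>_def using arccos_less_arccos[of 0 "r / 2"] r r2 by simp
  qed
  have "\<phi> \<noteq> pi / real m" if "m \<ge> 3" for m :: nat
    using no cos that unfolding mirror_bound_def by auto
  then obtain k where k: "sin (real k * \<phi>) \<noteq> 0" "\<bar>sin (real k * \<phi>)\<bar> \<le> sin (\<phi> / 2)"
    using small_sine_multiple[OF \<phi>] by blast
  then obtain n where n: "k = Suc n" by (cases k) auto
  have c: "cheb (r / 2) k * sin \<phi> = sin (real k * \<phi>)" using cheb_sin[of \<phi> k] by (simp add: cos)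
  have s: "sin (\<phi> / 2) > 0" "cos (\<phi> / 2) > 0" "sin \<phi> > 0"
    using \<phi> by (auto intro!: sin_gt_zero cos_gt_zero)
  have r0: "r \<noteq> 0" using r by simp
  have "1 \<le> cmod (of_real (- r * cheb (r / 2) k))"
    unfolding n
  proof (rule shimizu_leutbecher[OF L(1-3)])
    show "det (mat2 (of_real (- cheb (r / 2) n)) (of_real (cheb (r / 2) (Suc n) / r))
        (of_real (- r * cheb (r / 2) (Suc n))) (of_real (cheb (r / 2) (Suc (Suc n))))) = 1"
      using det_mpow[OF det_hecke[OF r0], of "Suc n"] unfolding hecke_power[OF r0] .
    show "mat2 (of_real (- cheb (r / 2) n)) (of_real (cheb (r / 2) (Suc n) / r))
        (of_real (- r * cheb (r / 2) (Suc n))) (of_real (cheb (r / 2) (Suc (Suc n)))) ** transl **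
      adj2 (mat2 (of_real (- cheb (r / 2) n)) (of_real (cheb (r / 2) (Suc n) / r))
        (of_real (- r * cheb (r / 2) (Suc n))) (of_real (cheb (r / 2) (Suc (Suc n))))) \<in> L"
      using hecke_power_conj_transl[OF L(2-4) r0, of "Suc n"] unfolding hecke_power[OF r0] .
    show "complex_of_real (- r * cheb (r / 2) (Suc n)) \<noteq> 0" using k(1) c r n by auto
  qed
  also have "cmod (of_real (- r * cheb (r / 2) k)) = r * \<bar>cheb (r / 2) k\<bar>"
    using r by (simp only: norm_of_real) (simp add: abs_mult)
  finally have "sin \<phi> \<le> r * (\<bar>cheb (r / 2) k\<bar> * sin \<phi>)"
    using s(3) mult_right_mono[of 1 "r * \<bar>cheb (r / 2) k\<bar>" "sin \<phi>"] by simp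
  also have "\<bar>cheb (r / 2) k\<bar> * sin \<phi> = \<bar>sin (real k * \<phi>)\<bar>"
    using c s(3) by (metis abs_mult abs_of_pos)
  also have "r * \<dots> \<le> r * sin (\<phi> / 2)" using k(2) r by (intro mult_left_mono) auto
  also have "\<dots> = 2 * cos \<phi> * sin (\<phi> / 2)" by (simp add: cos)
  also have "\<dots> < 2 * cos (\<phi> / 2) * sin (\<phi> / 2)"
    using \<phi> s(1) cos_monotone_0_pi[of "\<phi> / 2" \<phi>] by simp
  also have "\<dots> = sin \<phi>" using sin_double[of "\<phi> / 2"] by simp
  finally show False by simp
qed

section \<open>The type of an element and its trace\<close>

lemma mirror_bound_pos: "mirror_bound t \<Longrightarrow> t > 0"
proof -
  have "cos (pi / real m) > 0" if "m \<ge> 3" for m :: nat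
    using that by (intro cos_gt_zero_pi) (auto simp: field_simps intro: less_trans[of _ 0])
  then show "mirror_bound t \<Longrightarrow> t > 0" by (auto simp: mirror_bound_def)
qed

definition hyp_par_or_prim :: "(complex^2^2) set \<Rightarrow> bool"
  where "hyp_par_or_prim f \<longleftrightarrow> hyperbolic f \<or> parabolic f \<or> (\<exists>n\<ge>3. primitive_elliptic n f)"

lemma trace_rotation:
  assumes "det A = 1" "is_rotation \<theta> (psl A)"
  shows "(trace A)\<^sup>2 = (of_real (2 * cos (\<theta> / 2)))\<^sup>2"
proof -
  obtain q where q: "det q = 1" "conj_by q A = rotation_matrix \<theta> \<or> conj_by q A = - rotation_matrix \<theta>"
    using assms is_rotation_psl_iff by blast
  have "trace (rotation_matrix \<theta>) = of_real (2 * cos (\<theta> / 2))"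
    by (simp add: rotation_matrix_def complex_eq_iff)
  moreover have "trace (- Z) = - trace Z" for Z :: "complex^2^2"
    by (cases Z) simp
  ultimately show ?thesis using q conj_by_hom(6)[OF q(1), of A] by (metis power2_minus)
qed

text \<open>In each of the three cases the square of the trace is the square of a real number \<open>s\<close>
  with \<open>mirror_bound s\<close>, so the trace is \<open>\<plusminus>s\<close>.\<close>

lemma hyp_par_or_prim_imp_mirror_bound:
  assumes A: "det A = 1" and "hyp_par_or_prim (psl A)"
  shows "\<exists>\<tau>::real. trace A = of_real \<tau> \<and> mirror_bound \<bar>\<tau>\<bar>"
proof -
  have "\<exists>s. mirror_bound s \<and> (trace A)\<^sup>2 = (of_real s)\<^sup>2"
    using assms(2) unfolding hyp_par_or_prim_def
  proof (elim disjE exE conjE)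
    assume "hyperbolic (psl A)"
    then obtain b :: real where b: "b > 0" "(trace A)\<^sup>2 - 4 = of_real b"
      using A by (auto simp: hyperbolic_def beta_psl)
    have "mirror_bound (sqrt (b + 4))"
      using b(1) real_le_rsqrt[of 2 "b + 4"] by (simp add: mirror_bound_def)
    moreover have "(trace A)\<^sup>2 = (of_real (sqrt (b + 4)))\<^sup>2"
      using b by (simp add: algebra_simps flip: of_real_power)
    ultimately show ?thesis by blast
  next
    assume "parabolic (psl A)"
    then have "(trace A)\<^sup>2 = (of_real 2)\<^sup>2" using A by (simp add: parabolic_def beta_psl)
    moreover have "mirror_bound 2" by (simp add: mirror_bound_def)
    ultimately show ?thesis by blast
  next
    fix n :: nat assume n: "n \<ge> 3" "primitive_elliptic n (psl A)"
    then have "is_rotation (2 * pi / real n) (psl A)" by (simp add: primitive_elliptic_def)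
    then have "(trace A)\<^sup>2 = (of_real (2 * cos (2 * pi / real n / 2)))\<^sup>2"
      by (rule trace_rotation[OF A])
    moreover have "mirror_bound (2 * cos (2 * pi / real n / 2))"
      using n(1) by (auto simp: mirror_bound_def)
    ultimately show ?thesis by blast
  qed
  then obtain s where s: "mirror_bound s" "(trace A)\<^sup>2 = (of_real s)\<^sup>2" by blast
  have "trace A = of_real s \<or> trace A = of_real (- s)" using s(2) by (simp add: power2_eq_iff)
  moreover have "\<bar>s\<bar> = s" using mirror_bound_pos[OF s(1)] by simp
  ultimately show ?thesis using s(1) by (metis abs_minus_cancel)
qed

text \<open>With \<open>u = cis \<phi>\<close> and \<open>w = cis (- \<phi>)\<close> the eigenvectors are \<open>(1, r u)\<close> and \<open>(1, r w)\<close>; the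
  second is rescaled to give determinant 1.\<close>

lemma hecke_rotation:
  assumes \<phi>: "0 < \<phi>" "\<phi> < pi / 2"
  shows "\<exists>q. det q = 1 \<and> conj_by q (hecke (2 * cos \<phi>)) = rotation_matrix (2 * \<phi>)"
proof -
  define r where "r = 2 * cos \<phi>"
  define u where "u = cis \<phi>"
  define w where "w = cis (- \<phi>)"
  define \<delta> where "\<delta> = of_real r * (w - u)"
  have r: "of_real r = u + w" "r \<noteq> 0"
    using \<phi> cos_gt_zero[of \<phi>] by (simp_all add: r_def u_def w_def complex_eq_iff)
  have uw: "u * w = 1" by (simp add: u_def w_def cis_mult)
  have "sin \<phi> \<noteq> 0" using \<phi> sin_gt_zero[of \<phi>] by simp
  then have "w - u \<noteq> 0" by (simp add: u_def w_def complex_eq_iff)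
  then have \<delta>: "\<delta> \<noteq> 0" using r(2) by (simp add: \<delta>_def)
  define q where "q = mat2 1 (1 / \<delta>) (r * u) (r * w / \<delta>)"
  have "det q = (r * w - r * u) / \<delta>" by (simp add: q_def diff_divide_distrib)
  then have q: "det q = 1" using \<delta> by (simp add: \<delta>_def right_diff_distrib)
  have D: "rotation_matrix (2 * \<phi>) = mat2 u 0 0 w"
    by (simp add: rotation_matrix_def u_def w_def)
  have ru: "r * u - 1 = u * u" "r * w - 1 = w * w" using uw by (simp_all add: r(1) algebra_simps)
  have "hecke r ** q = q ** mat2 u 0 0 w"
  proof -
    have e: "r * (r * u) - r = r * u * u" "r * (r * w) - r = r * w * w"
      using arg_cong[OF ru(1), of "\<lambda>x. of_real r * x"] arg_cong[OF ru(2), of "\<lambda>x. of_real r * x"]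
      by (simp_all add: right_diff_distrib mult.assoc)
    then have "r * (r * w / \<delta>) - r / \<delta> = r * w * w / \<delta>"
      by (metis diff_divide_distrib times_divide_eq_right)
    then show ?thesis using e r(2) by (simp add: hecke_def q_def mult.commute)
  qed
  then have "conj_by q (hecke r) = rotation_matrix (2 * \<phi>)"
    using adj2_cancel(2)[OF q] by (simp add: conj_by_def D flip: matrix_mul_assoc)
  then show ?thesis using q unfolding r_def by blast
qed

lemma conj_by_conj_by: "conj_by q (conj_by p A) = conj_by (p ** q) A"
  by (simp add: conj_by_def adj2_mult matrix_mul_assoc)

text \<open>By \<open>hecke_power\<close> the off-diagonal entries of the \<open>n\<close>th power vanish when
  \<open>sin (n \<pi>/p) = 0\<close>. The recurrence then makes the diagonal entries equal, and the determinant makes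
  their square 1, so the power is already trivial in \<open>PSL2C\<close>.\<close>

lemma hecke_order:
  assumes H: "det H = 1" and q: "det q = 1" "conj_by q H = hecke (2 * cos (pi / real p))"
    and p: "p \<ge> 3"
  shows "group.ord PSL2C (psl H) = p"
proof -
  let ?r = "2 * cos (pi / real p)"
  let ?U = "cheb (?r / 2)"
  interpret group PSL2C by (rule group_PSL2C)
  have "mirror_bound ?r" using p by (auto simp: mirror_bound_def)
  then have r: "?r \<noteq> 0" using mirror_bound_pos by fastforce
  have "psl H [^]\<^bsub>PSL2C\<^esub> n = \<one>\<^bsub>PSL2C\<^esub> \<longleftrightarrow> p dvd n" for n
  proof (cases n)
    case (Suc k)
    have "psl H [^]\<^bsub>PSL2C\<^esub> n = \<one>\<^bsub>PSL2C\<^esub> \<longleftrightarrow> mpow H n = mat 1 \<or> mpow H n = - mat 1"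
      by (simp add: psl_pow H psl_one psl_eq_iff)
    also have "\<dots> \<longleftrightarrow> conj_by q (mpow H n) = mat 1 \<or> conj_by q (mpow H n) = - mat 1"
      by (metis conj_by_hom(2,3)[OF q(1)] conj_by_inverse(2)[OF q(1)])
    also have "conj_by q (mpow H n) = mpow (hecke ?r) n" by (simp add: conj_by_mpow q)
    also have "(mpow (hecke ?r) n = mat 1 \<or> mpow (hecke ?r) n = - mat 1) \<longleftrightarrow> ?U n = 0"
    proof
      assume "?U n = 0"
      moreover have "det (mpow (hecke ?r) n) = 1" by (rule det_mpow[OF det_hecke[OF r]])
      ultimately have "of_real (?U k) * of_real (?U k) = (1::complex)"
        using r unfolding Suc hecke_power[OF r] by simp
      then have "?U k * ?U k = 1" by (metis of_real_eq_1_iff of_real_mult)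
      then have "?U k = 1 \<or> ?U k = - 1" by (simp add: square_eq_1_iff)
      then show "mpow (hecke ?r) n = mat 1 \<or> mpow (hecke ?r) n = - mat 1"
        using \<open>?U n = 0\<close> unfolding Suc hecke_power[OF r] mat_1_mat2 by auto
    next
      assume "mpow (hecke ?r) n = mat 1 \<or> mpow (hecke ?r) n = - mat 1"
      then show "?U n = 0" using r unfolding Suc hecke_power[OF r] mat_1_mat2 by auto
    qed
    also have "\<dots> \<longleftrightarrow> sin (real n * (pi / real p)) = 0"
    proof -
      have "sin (pi / real p) > 0" using p by (intro sin_gt_zero) (auto simp: field_simps)
      then show ?thesis using cheb_sin[of "pi / real p" n] by auto
    qed
    also have "\<dots> \<longleftrightarrow> p dvd n"
    proof
      assume "sin (real n * (pi / real p)) = 0"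
      then obtain i :: int where "real n * (pi / real p) = of_int i * pi"
        by (auto simp: sin_zero_iff_int2)
      then have "real n = of_int i * real p" using p by (simp add: field_simps)
      then have "int n = i * int p" by (metis of_int_eq_iff of_int_mult of_int_of_nat_eq)
      then show "p dvd n" by (metis dvd_triv_right int_dvd_int_iff)
    next
      assume "p dvd n"
      then obtain j where "n = p * j" by blast
      then have "real n * (pi / real p) = real j * pi" using p by simp
      then show "sin (real n * (pi / real p)) = 0" by simp
    qed
    finally show ?thesis .
  qed (simp add: H psl_one)
  then show ?thesis using ord_unique[OF psl_carrier[OF H]] by blast
qed

lemma mirror_bound_imp_hyp_par_or_prim:
  assumes H: "det H = 1" and q: "det q = 1" "conj_by q H = hecke r" and r: "mirror_bound r"
  shows "hyp_par_or_prim (psl H)"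
proof -
  have r0: "r > 0" using r by (rule mirror_bound_pos)
  have car: "psl H \<in> carrier PSL2C" using H by (rule psl_carrier)
  have beta: "beta (psl H) = of_real (r\<^sup>2 - 4)"
    using conj_by_hom(6)[OF q(1), of H] by (simp add: beta_psl H q(2)) (simp add: hecke_def)
  have ne: "psl H \<noteq> \<one>\<^bsub>PSL2C\<^esub>"
  proof
    assume "psl H = \<one>\<^bsub>PSL2C\<^esub>"
    then have "hecke r = mat 1 \<or> hecke r = - mat 1"
      using conj_by_hom(2,3)[OF q(1)] q(2) by (metis psl_eq_iff psl_one)
    then show False using r0 by (auto simp: hecke_def mat_1_mat2)
  qed
  from r consider "r > 2" | "r = 2" | p :: nat where "p \<ge> 3" "r = 2 * cos (pi / real p)" "r < 2"
    unfolding mirror_bound_def by fastforce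
  then show ?thesis
  proof cases
    case 1
    then have "r\<^sup>2 > 2\<^sup>2" by (intro power_strict_mono) auto
    then have "hyperbolic (psl H)"
      unfolding hyperbolic_def using car ne beta by (intro conjI exI[of _ "r\<^sup>2 - 4"]) auto
    then show ?thesis by (simp add: hyp_par_or_prim_def)
  next
    case 2
    then have "parabolic (psl H)" using car ne beta by (simp add: parabolic_def)
    then show ?thesis by (simp add: hyp_par_or_prim_def)
  next
    case (3 p)
    have "r\<^sup>2 < 2\<^sup>2" using 3 r0 by (intro power_strict_mono) auto
    then have "elliptic (psl H)"
      unfolding elliptic_def using car ne beta r0 by (intro conjI exI[of _ "r\<^sup>2 - 4"]) auto
    moreover have "group.ord PSL2C (psl H) = p"
      using hecke_order[OF H q(1) _ 3(1)] q(2) 3(2) by simp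
    moreover have "is_rotation (2 * pi / real p) (psl H)"
    proof -
      have "0 < pi / real p" "pi / real p < pi / 2" using 3(1) by (auto simp: field_simps)
      then obtain u where u: "det u = 1" "conj_by u (hecke r) = rotation_matrix (2 * (pi / real p))"
        using hecke_rotation[of "pi / real p"] 3(2) by auto
      then have "det (q ** u) = 1" "conj_by (q ** u) H = rotation_matrix (2 * pi / real p)"
        using q by (simp_all add: det_mul flip: conj_by_conj_by)
      then show ?thesis using is_rotation_psl_iff[OF H] by blast
    qed
    ultimately show ?thesis using 3(1) by (auto simp: hyp_par_or_prim_def primitive_elliptic_def)
  qed
qed

section \<open>Normal form\<close>

lemma conj_by_eqI: "det q = 1 \<Longrightarrow> A ** q = q ** Z \<Longrightarrow> conj_by q A = Z"
  using adj2_cancel(2) by (simp add: conj_by_def flip: matrix_mul_assoc)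

text \<open>The new basis consists of a vector outside the eigenspace, preceded by its image under
  \<open>B - 1\<close>. It is scaled to determinant 1, which is possible over the complex numbers; the first basis
  vector serves unless it is itself an eigenvector.\<close>

lemma parabolic_conj_transl:
  assumes B: "det B = 1" "trace B = 2" "B \<noteq> mat 1"
  shows "\<exists>q. det q = 1 \<and> conj_by q B = transl"
proof -
  obtain a b c d where abcd: "B = mat2 a b c d" by (cases B)
  have d: "d = 2 - a" using B(2) by (simp add: abcd algebra_simps)
  have det: "b * c = - (a - 1)\<^sup>2" using B(1) by (simp add: abcd d power2_eq_square algebra_simps)
  show ?thesis
  proof (cases "c = 0")
    case False
    define s where "s = csqrt (- 1 / c)"
    have s: "s * s = - 1 / c" unfolding s_def using power2_csqrt[of "- 1 / c"] by (simp only: power2_eq_square)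
    define q where "q = mat2 (s * (a - 1)) s (s * c) 0"
    have "det q = 1" using False s by (simp add: q_def mult.assoc[symmetric])
    moreover have "B ** q = q ** transl"
    proof -
      have "a * (s * (a - 1)) + b * (s * c) = s * (a * (a - 1) + b * c)" by (simp add: algebra_simps)
      also have "\<dots> = s * (a - 1)" by (simp add: det power2_eq_square algebra_simps)
      finally show ?thesis by (simp add: q_def abcd transl_def d algebra_simps)
    qed
    ultimately show ?thesis using conj_by_eqI by blast
  next
    case True
    then have a: "a = 1" using det by simp
    have b: "b \<noteq> 0" using B(3) True a d by (auto simp: abcd mat_1_mat2)
    define s where "s = csqrt (1 / b)"
    have s: "s * s = 1 / b" unfolding s_def using power2_csqrt[of "1 / b"] by (simp only: power2_eq_square)
    define q where "q = mat2 (s * b) 0 0 s"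
    have "det q = (s * s) * b" by (simp add: q_def)
    then have "det q = 1" using b by (simp add: s)
    moreover have "B ** q = q ** transl"
      by (simp add: q_def abcd transl_def a d True)
    ultimately show ?thesis using conj_by_eqI by blast
  qed
qed

lemma parabolic_lift:
  assumes "parabolic g"
  shows "\<exists>B. det B = 1 \<and> trace B = 2 \<and> B \<noteq> mat 1 \<and> g = psl B"
proof -
  obtain B where B: "det B = 1" "g = psl B"
    using assms PSL2C_cases unfolding parabolic_def by metis
  have tm: "trace (- Z) = - trace Z" for Z :: "complex^2^2" by (cases Z) simp
  have "(trace B)\<^sup>2 = 2\<^sup>2" using assms B by (simp add: parabolic_def beta_psl)
  then have "trace B = 2 \<or> trace B = - 2" by (simp only: power2_eq_iff)
  then have "trace B = 2 \<or> trace (- B) = 2" by (auto simp: tm)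
  moreover have "psl (- B) = psl B" "det (- B) = 1" using B by (auto simp: psl_def det_neg_2)
  moreover have "B \<noteq> mat 1" "B \<noteq> - mat 1"
    using assms B psl_eq_iff[of B "mat 1"] by (auto simp: parabolic_def psl_one)
  moreover have "- B \<noteq> mat 1" using \<open>B \<noteq> - mat 1\<close> by (metis minus_minus)
  ultimately show ?thesis using B by metis
qed

text \<open>Conjugating by a further translation fixes \<open>g\<close> and makes the upper left entry of \<open>f\<close> zero;
  trace and determinant determine the rest.\<close>

lemma conj_inversion_form:
  assumes A: "det A = 1" and q: "det q = 1" "conj_by q B = transl" and c: "conj_by q A $ 2 $ 1 \<noteq> 0"
  shows "\<exists>p c. det p = 1 \<and> conj_by p B = transl \<and> c \<noteq> 0 \<and> conj_by p A = mat2 0 (- 1 / c) c (trace A)"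
proof -
  obtain a b c d where abcd: "conj_by q A = mat2 a b c d" by (cases "conj_by q A")
  have c0: "c \<noteq> 0" using c abcd by simp
  define T where "T = mat2 1 (a / c) 0 1"
  have T: "det T = 1" by (simp add: T_def)
  have "det (q ** T) = 1" using q T by (simp add: det_mul)
  moreover have "conj_by (q ** T) B = transl"
    unfolding conj_by_conj_by[symmetric] q(2) by (simp add: conj_by_def T_def transl_def)
  moreover have "conj_by (q ** T) A = mat2 0 (- 1 / c) c (trace A)"
  proof -
    have tr: "trace A = a + d" and dt: "a * d - b * c = 1"
      using conj_by_hom(5,6)[OF q(1), of A] A by (simp_all add: abcd)
    have "b * c = a * d - 1" using dt by (simp add: algebra_simps)
    then have b: "b = (a * d - 1) / c" using c0 by (simp add: field_simps)
    show ?thesis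
      unfolding conj_by_conj_by[symmetric] abcd b using c0
      by (simp add: conj_by_def T_def tr field_simps)
  qed
  ultimately show ?thesis using c0 by blast
qed

lemma trace_commutator:
  assumes "det A = 1" "det B = 1" "det q = 1" "conj_by q B = transl" "conj_by q A = mat2 0 (- 1 / c) c t" "c \<noteq> 0"
  shows "gamma (psl A) (psl B) = c\<^sup>2"
proof -
  have "trace (A ** B ** adj2 A ** adj2 B) = trace (conj_by q (A ** B ** adj2 A ** adj2 B))"
    by (rule conj_by_hom(6)[OF assms(3), symmetric])
  also have "conj_by q (A ** B ** adj2 A ** adj2 B) =
      conj_by q A ** conj_by q B ** adj2 (conj_by q A) ** adj2 (conj_by q B)"
    by (simp add: conj_by_hom assms(3))
  also have "trace \<dots> = 2 + c\<^sup>2"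
    using assms(6) unfolding assms(4,5) by (simp add: transl_def power2_eq_square algebra_simps)
  finally show ?thesis using assms by (simp add: gamma_psl)
qed

text \<open>Real matrices preserve the plane \<open>Im z = 0\<close>, whose Hermitian matrix is \<open>H\<close>; transport by \<open>q\<close>
  gives a plane for the original pair.\<close>

lemma real_pair_has_invariant_plane:
  assumes AB: "det A = 1" "det B = 1" and q: "det q = 1"
    and "conj_by q B = transl" "conj_by q A = mat2 0 (- 1 / of_real c) (of_real c) (of_real t)" "c \<noteq> 0"
  shows "has_invariant_plane (generate PSL2C {psl A, psl B})"
proof -
  define H where "H = mat2 0 (- \<i>) \<i> 0"
  have *: "act_herm Z (act_herm q H) = act_herm q (act_herm (conj_by q Z) H)" for Z
    by (simp add: conj_by_def adj2_cancel[OF q] flip: act_herm_mult matrix_mul_assoc)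
  show ?thesis
  proof (rule has_invariant_plane_generate[OF AB(1) _ AB(2)])
    show "act_herm A (act_herm q H) = act_herm q H"
      unfolding * assms using assms(6) by (simp add: act_herm_def H_def)
    show "act_herm B (act_herm q H) = act_herm q H"
      unfolding * assms by (simp add: act_herm_def H_def transl_def)
    show "ctrans (act_herm q H) = act_herm q H"
      by (simp add: act_herm_def ctrans_mult matrix_mul_assoc) (simp add: H_def)
    show "Re (det (act_herm q H)) < 0" using q by (simp add: H_def)
  qed
qed

text \<open>Non-elementarity gives \<open>c \<noteq> 0\<close>, the real parameter \<open>\<gamma> = c\<^sup>2\<close> gives \<open>c\<close> real or imaginary,
  and the absence of an invariant plane excludes the first. The choice of the lift of \<open>f\<close> makes the
  imaginary part of \<open>c\<close> positive, so the sign of \<open>\<tau>\<close> cannot be prescribed as well.\<close>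

lemma normal_form:
  assumes f: "f \<in> carrier PSL2C" "hyp_par_or_prim f" and g: "parabolic g" and "gamma f g \<in> \<real>"
    and "\<not> elementary (generate PSL2C {f, g})" "\<not> has_invariant_plane (generate PSL2C {f, g})"
  shows "\<exists>A B q r \<tau>. det A = 1 \<and> det B = 1 \<and> det q = 1 \<and> f = psl A \<and> g = psl B \<and>
    conj_by q A = inversion r \<tau> \<and> conj_by q B = transl \<and> r > 0 \<and> \<tau> \<noteq> 0 \<and> mirror_bound \<bar>\<tau>\<bar>"
proof -
  obtain A where A: "det A = 1" "f = psl A" using f(1) by (rule PSL2C_cases)
  obtain B where B: "det B = 1" "trace B = 2" "B \<noteq> mat 1" "g = psl B"
    using parabolic_lift[OF g] by blast
  obtain q1 where q1: "det q1 = 1" "conj_by q1 B = transl" using parabolic_conj_transl B by blast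
  have "conj_by q1 A $ 2 $ 1 \<noteq> 0"
    using elementary_generate[OF q1(1) A(1) _ B(1)] assms(5) A(2) B(4) q1(2)
    by (auto simp: transl_def)
  then obtain q c where q: "det q = 1" "conj_by q B = transl" "c \<noteq> 0" "conj_by q A = mat2 0 (- 1 / c) c (trace A)"
    using conj_inversion_form[OF A(1) q1] by blast
  obtain t where t: "trace A = of_real t" "mirror_bound \<bar>t\<bar>"
    using hyp_par_or_prim_imp_mirror_bound[OF A(1)] f(2) A(2) by blast
  have "c\<^sup>2 \<in> \<real>" using trace_commutator[OF A(1) B(1) q(1,2,4,3)] assms(4) A(2) B(4) by simp
  then obtain k where k: "c\<^sup>2 = of_real k" by (elim Reals_cases)
  have "k \<noteq> 0" using k q(3) by auto
  have "\<not> k > 0"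
  proof
    assume "k > 0"
    then have "c\<^sup>2 = (of_real (sqrt k))\<^sup>2" using k by (simp flip: of_real_power)
    then have "c = of_real (sqrt k) \<or> c = of_real (- sqrt k)" by (simp add: power2_eq_iff)
    then obtain x :: real where x: "c = of_real x" by blast
    show False
      using real_pair_has_invariant_plane[OF A(1) B(1) q(1,2), of x t] q(3,4) assms(6) A(2) B(4)
      by (simp add: x t(1))
  qed
  define r where "r = sqrt (- k)"
  have r: "r > 0" using \<open>k \<noteq> 0\<close> \<open>\<not> k > 0\<close> by (simp add: r_def)
  have "r\<^sup>2 = - k" using \<open>\<not> k > 0\<close> by (simp add: r_def)
  then have "c\<^sup>2 = (\<i> * of_real r)\<^sup>2" by (simp add: k power_mult_distrib flip: of_real_power)
  then have "c = \<i> * of_real r \<or> c = - (\<i> * of_real r)" by (simp add: power2_eq_iff)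
  then show ?thesis
  proof
    assume c: "c = \<i> * of_real r"
    have "conj_by q A = inversion r t" using q(4) r by (simp add: c t(1) inversion_def field_simps)
    then show ?thesis using A B q r t mirror_bound_pos[OF t(2)]
      by (intro exI[of _ A] exI[of _ B] exI[of _ q] exI[of _ r] exI[of _ t]) auto
  next
    assume c: "c = - (\<i> * of_real r)"
    have "conj_by q (- A) = inversion r (- t)"
      using q r by (simp add: conj_by_hom c t(1) inversion_def field_simps)
    moreover have "f = psl (- A)" "det (- A) = 1" using A by (auto simp: psl_def det_neg_2)
    ultimately show ?thesis using B q r t mirror_bound_pos[OF t(2)]
      by (intro exI[of _ "- A"] exI[of _ B] exI[of _ q] exI[of _ r] exI[of _ "- t"]) auto
  qed
qed

text \<open>The unknown is \<open>H\<close>, where \<open>M\<close> is the commutator and the \<open>\<plusminus>\<close> comes from working with lifts.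
  Its lower left entry is nonzero, so \<open>H transl\<close> is not diagonal; being a square root of \<open>\<plusminus>1\<close> it has
  trace zero. This leaves two unknowns, and \<open>H\<^sup>2 = M\<close> turns out to be contradictory while
  \<open>H\<^sup>2 = - M\<close> gives \<open>\<plusminus> hecke r\<close>.\<close>

lemma hecke_characterization:
  fixes r \<tau> :: real
  assumes H: "det H = 1" and r: "r \<noteq> 0"
  defines "M \<equiv> inversion r \<tau> ** transl ** adj2 (inversion r \<tau>) ** adj2 transl"
  shows "(H ** H = M \<or> H ** H = - M) \<and>
      (H ** transl ** (H ** transl) = mat 1 \<or> H ** transl ** (H ** transl) = - mat 1) \<longleftrightarrow>
    H = hecke r \<or> H = - hecke r"
proof -
  have M: "M = mat2 1 (- 1) (of_real r * of_real r) (1 - of_real r * of_real r)"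
    using r by (simp add: M_def inversion_def transl_def algebra_simps)
  show ?thesis
  proof
    assume *: "(H ** H = M \<or> H ** H = - M) \<and>
      (H ** transl ** (H ** transl) = mat 1 \<or> H ** transl ** (H ** transl) = - mat 1)"
    obtain a b c d where abcd: "H = mat2 a b c d" by (cases H)
    let ?r = "complex_of_real r"
    have "c * a + d * c = ?r * ?r \<or> c * a + d * c = - (?r * ?r)"
      using * by (auto simp: abcd M)
    then have c: "c \<noteq> 0" using r by auto
    have "c * (a + c + d) = 0"
      using * by (auto simp: abcd transl_def mat_1_mat2 algebra_simps)
    then have "a + c + d = 0" using c by (simp only: mult_eq_0_iff simp_thms)
    then have d: "d = - a - c" using minus_unique[of "a + c" d] by simp
    have det: "- (a * a) - a * c - b * c = 1" using H by (simp add: abcd d algebra_simps)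
    from * have "H ** H = M \<or> H ** H = - M" by blast
    then show "H = hecke r \<or> H = - hecke r"
    proof
      assume "H ** H = M"
      then have "a * a + b * c = 1" "a * b + b * d = - 1" by (simp_all add: abcd M)
      then have "b * c = 1" "a * a = 0" by (auto simp: d algebra_simps)
      then show ?thesis using det by simp
    next
      assume "H ** H = - M"
      then have e: "a * a + b * c = - 1" "a * b + b * d = 1" "c * a + d * c = - (?r * ?r)"
        by (simp_all add: abcd M)
      then have bc: "b * c = - 1" by (simp add: d algebra_simps) (metis minus_minus)
      then have a: "a = 0" using e(1) by simp
      have "c\<^sup>2 = ?r\<^sup>2" using e(3) by (simp add: d a power2_eq_square)
      then have "c = ?r \<or> c = - ?r" by (simp add: power2_eq_iff)
      moreover have "b = - 1 / c" using bc c by (simp add: field_simps)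
      ultimately show ?thesis by (auto simp: abcd hecke_def a d)
    qed
  next
    assume "H = hecke r \<or> H = - hecke r"
    then show "(H ** H = M \<or> H ** H = - M) \<and>
      (H ** transl ** (H ** transl) = mat 1 \<or> H ** transl ** (H ** transl) = - mat 1)"
      using r by (auto simp: M hecke_def transl_def mat_1_mat2 algebra_simps)
  qed
qed

section \<open>The discreteness criterion\<close>

lemma square_root_of_commutator_iff:
  assumes A: "det A = 1" and B: "det B = 1" and q: "det q = 1" "conj_by q A = inversion r \<tau>" "conj_by q B = transl"
    and r: "r \<noteq> 0" and H: "det H = 1"
  shows "psl H [^]\<^bsub>PSL2C\<^esub> (2::nat) =
        psl A \<otimes>\<^bsub>PSL2C\<^esub> psl B \<otimes>\<^bsub>PSL2C\<^esub> inv\<^bsub>PSL2C\<^esub> (psl A) \<otimes>\<^bsub>PSL2C\<^esub> inv\<^bsub>PSL2C\<^esub> (psl B)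
      \<and> (psl H \<otimes>\<^bsub>PSL2C\<^esub> psl B) [^]\<^bsub>PSL2C\<^esub> (2::nat) = \<one>\<^bsub>PSL2C\<^esub> \<longleftrightarrow>
    conj_by q H = hecke r \<or> conj_by q H = - hecke r"
proof -
  let ?M = "A ** B ** adj2 A ** adj2 B"
  have inj: "conj_by q Y = conj_by q Z \<longleftrightarrow> Y = Z" for Y Z
    using conj_by_inverse(2)[OF q(1)] by metis
  have "psl Y = psl Z \<longleftrightarrow> conj_by q Y = conj_by q Z \<or> conj_by q Y = - conj_by q Z" for Y Z
    unfolding psl_eq_iff using inj conj_by_hom(3)[OF q(1)] by metis
  note psl_eq = this
  have sq: "mpow Z 2 = Z ** Z" for Z by (simp add: numeral_2_eq_2)
  have "psl A \<otimes>\<^bsub>PSL2C\<^esub> psl B \<otimes>\<^bsub>PSL2C\<^esub> inv\<^bsub>PSL2C\<^esub> (psl A) \<otimes>\<^bsub>PSL2C\<^esub> inv\<^bsub>PSL2C\<^esub> (psl B) = psl ?M"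
    using A B by (simp add: psl_inv psl_mult det_mul)
  moreover have "psl H [^]\<^bsub>PSL2C\<^esub> (2::nat) = psl (H ** H)"
    using H by (simp add: psl_pow sq)
  moreover have "(psl H \<otimes>\<^bsub>PSL2C\<^esub> psl B) [^]\<^bsub>PSL2C\<^esub> (2::nat) = psl (H ** B ** (H ** B))"
    using H B by (simp add: psl_mult psl_pow det_mul sq)
  ultimately show ?thesis
    unfolding psl_one
    using hecke_characterization[of "conj_by q H" r \<tau>] H r
    by (simp add: psl_eq conj_by_hom[OF q(1)] q)
qed

text \<open>Both the discreteness of the group and the type of \<open>h\<close> are equivalent to
  \<open>mirror_bound r\<close>.\<close>

theorem discrete_iff_hyp_par_or_prim:
  assumes A: "det A = 1" and B: "det B = 1" and q: "det q = 1" "conj_by q A = inversion r \<tau>" "conj_by q B = transl"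
    and r: "r > 0" and \<tau>: "\<tau> \<noteq> 0" "mirror_bound \<bar>\<tau>\<bar>"
    and H: "det H = 1" "conj_by q H = hecke r \<or> conj_by q H = - hecke r"
  shows "discrete_PSL2C (generate PSL2C {psl A, psl B}) \<longleftrightarrow> hyp_par_or_prim (psl H)"
proof -
  let ?G = "generate PSL2C {psl A, psl B}"
  have G: "subgroup ?G PSL2C"
    using A B by (intro group.generate_is_subgroup[OF group_PSL2C]) (auto simp: psl_carrier)
  define L where "L = conj_by q ` (\<Union>?G)"
  have L: "matrix_group L" unfolding L_def by (intro matrix_group_conj q matrix_group_lifts G)
  have "A \<in> \<Union>?G" "B \<in> \<Union>?G"
    using generate.incl[of "psl A" "{psl A, psl B}" PSL2C] generate.incl[of "psl B" "{psl A, psl B}" PSL2C]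
      psl_self by auto
  then have gens: "transl \<in> L" "inversion r \<tau> \<in> L"
    unfolding L_def q(2,3)[symmetric] by blast+
  have discrete: "discrete_PSL2C ?G \<longleftrightarrow> discrete_lifts L"
    unfolding L_def discrete_PSL2C_iff_lifts[OF G] discrete_lifts_conj[OF q(1)] ..
  obtain H' where H': "det H' = 1" "psl H' = psl H" "conj_by q H' = hecke r"
  proof (cases "conj_by q H = hecke r")
    case False
    then have "conj_by q (- H) = hecke r" using H(2) by (simp add: conj_by_hom[OF q(1)])
    then show ?thesis using H(1) that[of "- H"] by (auto simp: psl_def det_neg_2)
  qed (use H(1) that in blast)
  have tr: "trace H' = of_real r"
    using conj_by_hom(6)[OF q(1), of H'] H'(3) by (simp add: hecke_def)
  show ?thesis
  proof
    assume "discrete_PSL2C ?G"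
    then have "mirror_bound r" using discrete_imp_mirror_bound[OF _ L gens r] discrete by simp
    then show "hyp_par_or_prim (psl H)"
      using mirror_bound_imp_hyp_par_or_prim[OF H'(1) q(1) H'(3)] H'(2) by simp
  next
    assume "hyp_par_or_prim (psl H)"
    then have "mirror_bound r"
      using hyp_par_or_prim_imp_mirror_bound[OF H'(1)] H'(2) r by (auto simp: tr)
    then obtain K where K: "matrix_group K" "transl \<in> K" "inversion r \<tau> \<in> K" "discrete_lifts K"
      using discrete_reflection_group[OF r _ \<tau>] by blast
    have "\<Union>?G \<subseteq> conj_by (adj2 q) ` K"
    proof (intro Union_least generate_lifts_subset[OF A B])
      show "matrix_group (conj_by (adj2 q) ` K)" using q K by (intro matrix_group_conj) simp_all
      show "A \<in> conj_by (adj2 q) ` K" "B \<in> conj_by (adj2 q) ` K"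
        using K q by (metis conj_by_inverse(2)[OF q(1)] image_eqI)+
    qed
    then have "L \<subseteq> K" unfolding L_def by (auto simp: conj_by_inverse(1)[OF q(1)])
    then have "discrete_lifts L" using K(4) unfolding discrete_lifts_def by blast
    then show "discrete_PSL2C ?G" using discrete by simp
  qed
qed

theorem theorem2p3:
  fixes f g :: "(complex^2^2) set"
  defines "\<Gamma> \<equiv> generate PSL2C {f, g}"
  assumes "f \<in> carrier PSL2C" and "g \<in> carrier PSL2C"
    and "hyperbolic f \<or> parabolic f \<or> (\<exists>n\<ge>3. primitive_elliptic n f)"
    and "parabolic g"
    and "RP_group f g"
    and "\<not> elementary \<Gamma>"
    and "\<not> has_invariant_plane \<Gamma>"
  shows "(\<exists>h\<in>carrier PSL2C.
            h [^]\<^bsub>PSL2C\<^esub> (2::nat) = f \<otimes>\<^bsub>PSL2C\<^esub> g \<otimes>\<^bsub>PSL2C\<^esub> inv\<^bsub>PSL2C\<^esub> f \<otimes>\<^bsub>PSL2C\<^esub> inv\<^bsub>PSL2C\<^esub> g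
          \<and> (h \<otimes>\<^bsub>PSL2C\<^esub> g) [^]\<^bsub>PSL2C\<^esub> (2::nat) = \<one>\<^bsub>PSL2C\<^esub>)
    \<and> (\<forall>h\<in>carrier PSL2C.
            h [^]\<^bsub>PSL2C\<^esub> (2::nat) = f \<otimes>\<^bsub>PSL2C\<^esub> g \<otimes>\<^bsub>PSL2C\<^esub> inv\<^bsub>PSL2C\<^esub> f \<otimes>\<^bsub>PSL2C\<^esub> inv\<^bsub>PSL2C\<^esub> g
          \<and> (h \<otimes>\<^bsub>PSL2C\<^esub> g) [^]\<^bsub>PSL2C\<^esub> (2::nat) = \<one>\<^bsub>PSL2C\<^esub>
          \<longrightarrow> (discrete_PSL2C \<Gamma> \<longleftrightarrow>
                 hyperbolic h \<or> parabolic h \<or> (\<exists>p\<ge>3. primitive_elliptic p h)))"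
proof -
  have "\<exists>A B q r \<tau>. det A = 1 \<and> det B = 1 \<and> det q = 1 \<and> f = psl A \<and> g = psl B \<and>
      conj_by q A = inversion r \<tau> \<and> conj_by q B = transl \<and> r > 0 \<and> \<tau> \<noteq> 0 \<and> mirror_bound \<bar>\<tau>\<bar>"
    using assms by (intro normal_form) (simp_all add: hyp_par_or_prim_def RP_group_def)
  then obtain A B q r \<tau> where A: "det A = 1" "f = psl A" and B: "det B = 1" "g = psl B"
    and q: "det q = 1" "conj_by q A = inversion r \<tau>" "conj_by q B = transl"
    and r: "r > 0" and \<tau>: "\<tau> \<noteq> 0" "mirror_bound \<bar>\<tau>\<bar>" by blast
  have r0: "r \<noteq> 0" using r by simp
  note root_iff = square_root_of_commutator_iff[OF A(1) B(1) q r0, folded A(2) B(2)]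
  have D: "discrete_PSL2C \<Gamma> \<longleftrightarrow> hyp_par_or_prim (psl H)"
    if "det H = 1" "conj_by q H = hecke r \<or> conj_by q H = - hecke r" for H
    unfolding \<Gamma>_def A(2) B(2) using A B q r \<tau> that by (intro discrete_iff_hyp_par_or_prim)
  show ?thesis
  proof (intro conjI ballI impI)
    let ?H = "conj_by (adj2 q) (hecke r)"
    have "det ?H = 1" using q det_hecke[OF r0] by (simp add: conj_by_hom)
    then show "\<exists>h\<in>carrier PSL2C.
        h [^]\<^bsub>PSL2C\<^esub> (2::nat) = f \<otimes>\<^bsub>PSL2C\<^esub> g \<otimes>\<^bsub>PSL2C\<^esub> inv\<^bsub>PSL2C\<^esub> f \<otimes>\<^bsub>PSL2C\<^esub> inv\<^bsub>PSL2C\<^esub> g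
      \<and> (h \<otimes>\<^bsub>PSL2C\<^esub> g) [^]\<^bsub>PSL2C\<^esub> (2::nat) = \<one>\<^bsub>PSL2C\<^esub>"
      using root_iff[of ?H] psl_carrier[of ?H] by (auto simp: conj_by_inverse[OF q(1)])
  next
    fix h assume h: "h \<in> carrier PSL2C" and
      root: "h [^]\<^bsub>PSL2C\<^esub> (2::nat) = f \<otimes>\<^bsub>PSL2C\<^esub> g \<otimes>\<^bsub>PSL2C\<^esub> inv\<^bsub>PSL2C\<^esub> f \<otimes>\<^bsub>PSL2C\<^esub> inv\<^bsub>PSL2C\<^esub> g
      \<and> (h \<otimes>\<^bsub>PSL2C\<^esub> g) [^]\<^bsub>PSL2C\<^esub> (2::nat) = \<one>\<^bsub>PSL2C\<^esub>"
    obtain H where H: "det H = 1" "h = psl H" using h by (rule PSL2C_cases)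
    have "conj_by q H = hecke r \<or> conj_by q H = - hecke r"
      using root_iff[OF H(1)] root unfolding H(2) by blast
    then show "discrete_PSL2C \<Gamma> \<longleftrightarrow>
        hyperbolic h \<or> parabolic h \<or> (\<exists>p\<ge>3. primitive_elliptic p h)"
      using D[OF H(1)] unfolding H(2) hyp_par_or_prim_def by blast
  qed
qed

end
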